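(* Let $A\in\mathbb{R}^{n\times n}$ and $v,w\in\mathbb{R}^n$, and set $B=A+vw^T$. Assume the nonresonance hypothesis: for all (complex) eigenvalues $\alpha,\alpha'\in\sigma(A)$ and $\beta,\beta'\in\sigma(B)$ (possibly $\alpha=\alpha'$ or $\beta=\beta'$), one has $\alpha\alpha'\neq1$, $\beta\beta'\neq1$ and $\alpha\beta\neq1$. Let $P,Q,R\in\mathbb{R}^{n\times n}$ be the unique solutions of $$P-APA^T=vv^T,\qquad Q-B^TQB=ww^T,\qquad R-ARB=vw^T.$$ Suppose that $P$ and $Q$ are nonsingular. Then $R$ and $I+PQ$ are also nonsingular, and $$\sigma\!\left(P^{-1}RQ^{-1}R^T\right)=\sigma\!\left((I+PQ)^{-1}\right),$$ where eigenvalues are counted with algebraic multiplicity; equivalently, the two matrices $P^{-1}RQ^{-1}R^T$ and $(I+PQ)^{-1}$ have the same characteristic polynomial. Additionally, if $A$ and $B$ have simple, nonzero spectra (each has $n$ distinct complex eigenvalues, all nonzero), then the two matrices $P^{-1}RQ^{-1}R^T$ and $(I+PQ)^{-1}$ are similar.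
   Context: $\sigma(X)$ denotes the spectrum (set, or multiset when multiplicities are counted, of complex eigenvalues) of a square matrix $X$. Under the nonresonance hypothesis each of the three displayed linear (Stein) equations has exactly one solution, because the vectorized operators $I-A\otimes A$, $I-B^T\otimes B^T$, $I-B^T\otimes A$ have eigenvalues $1-\alpha\alpha'$, $1-\beta\beta'$, $1-\alpha\beta$ respectively. *)

theory Defs
  imports "Jordan_Normal_Form.Spectral_Radius"
begin

definition outer_prod :: "'a::semiring_0 vec \<Rightarrow> 'a vec \<Rightarrow> 'a mat" where
  "outer_prod v w = mat (dim_vec v) (dim_vec w) (\<lambda>(i, j). v $ i * w $ j)"

definition cspectrum :: "real mat \<Rightarrow> complex set" where
  "cspectrum X = spectrum (map_mat complex_of_real X)"

text \<open>Complex eigenvalues counted with algebraic multiplicity, i.e. with their order as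
  roots of the characteristic polynomial.\<close>
definition cspectrum_mset :: "real mat \<Rightarrow> complex multiset" where
  "cspectrum_mset X = proots (char_poly (map_mat complex_of_real X))"

text \<open>\<^const>\<open>mat_inverse\<close> is option-valued and returns \<^const>\<open>None\<close> on singular
  matrices; the value of the total version below is the inverse only for invertible matrices.\<close>
definition minv :: "'a::field mat \<Rightarrow> 'a mat" where
  "minv X = the (mat_inverse X)"

definition simple_nonzero_spectrum :: "real mat \<Rightarrow> bool" where
  "simple_nonzero_spectrum X \<longleftrightarrow> card (cspectrum X) = dim_row X \<and> 0 \<notin> cspectrum X"

end

theory Submission
  imports Defs
begin

text \<open>The defect of \<open>Q\<^sup>-\<^sup>1 - B Q\<^sup>-\<^sup>1 B\<^sup>T\<close> is a rank-one matrix \<open>s m m\<^sup>T\<close>, with \<open>B Q\<^sup>-\<^sup>1 w = - s d m\<close>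
  and \<open>w \<bullet> Q\<^sup>-\<^sup>1 w = 1 - s d\<^sup>2\<close> for some \<open>d\<close>. Consequently \<open>X = Q\<^sup>-\<^sup>1 + P\<close> and \<open>Y = P - R Q\<^sup>-\<^sup>1 R\<^sup>T\<close>
  satisfy the same kind of Stein equation as \<open>P\<close>, namely \<open>X - A X A\<^sup>T = s f f\<^sup>T\<close> and
  \<open>Y - A Y A\<^sup>T = s e e\<^sup>T\<close> with \<open>f = m - d v\<close> and \<open>e = A R m + d v\<close>. As \<open>P\<close> is invertible, \<open>v\<close> is
  cyclic for \<open>A\<close>, so \<open>e = E v\<close> and \<open>f = L v\<close> for matrices \<open>E\<close>, \<open>L\<close> commuting with \<open>A\<close>, and uniqueness
  gives \<open>X = s L P L\<^sup>T\<close> and \<open>Y = s E P E\<^sup>T\<close>. Here \<open>E\<close> is the transfer function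
  \<open>d + x w\<^sup>T (1 - x B)\<^sup>-\<^sup>1 m\<close> evaluated at \<open>A\<close>, and its inner character amounts to \<open>s E L = -1\<close>.
  Hence \<open>(1 + P Q)\<^sup>-\<^sup>1 = 1 - s P E\<^sup>T P\<^sup>-\<^sup>1 E\<close> and \<open>P\<^sup>-\<^sup>1 R Q\<^sup>-\<^sup>1 R\<^sup>T = 1 - s P\<^sup>-\<^sup>1 E P E\<^sup>T\<close> are
  conjugate by the invertible matrix \<open>P\<^sup>-\<^sup>1 E\<close>.\<close>

declare minus_carrier_mat [simp]

section \<open>Rank-one matrices and matrix algebra\<close>

lemma index_mult_mat_sum:
  assumes "A \<in> carrier_mat m n" "B \<in> carrier_mat n p" "i < m" "j < p"
  shows "(A * B) $$ (i, j) = (\<Sum>k\<in>{0..<n}. A $$ (i, k) * B $$ (k, j))"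
  using assms by (simp add: scalar_prod_def)

lemma outer_prod_carrier [simp]:
  "v \<in> carrier_vec n \<Longrightarrow> w \<in> carrier_vec m \<Longrightarrow> outer_prod v w \<in> carrier_mat n m"
  by (simp add: outer_prod_def)

lemma index_outer_prod [simp]:
  "i < dim_vec v \<Longrightarrow> j < dim_vec w \<Longrightarrow> outer_prod v w $$ (i, j) = v $ i * w $ j"
  by (simp add: outer_prod_def)

lemma dim_outer_prod [simp]:
  "dim_row (outer_prod v w) = dim_vec v" "dim_col (outer_prod v w) = dim_vec w"
  by (simp_all add: outer_prod_def)

lemma transpose_outer_prod:
  "transpose_mat (outer_prod v w) = outer_prod w (v :: 'a :: comm_semiring_0 vec)"
  by (rule eq_matI) (auto simp: mult.commute)

lemma mult_outer_prod:
  assumes "M \<in> carrier_mat m n" "v \<in> carrier_vec n"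
  shows "M * outer_prod v w = outer_prod (M *\<^sub>v v) w"
  by (rule eq_matI, insert assms, auto simp: scalar_prod_def sum_distrib_right mult.assoc)

lemma outer_prod_mult:
  fixes w :: "'a :: comm_semiring_0 vec"
  assumes "M \<in> carrier_mat n m" "w \<in> carrier_vec n"
  shows "outer_prod v w * M = outer_prod v (transpose_mat M *\<^sub>v w)"
  by (rule eq_matI, insert assms, auto simp: scalar_prod_def sum_distrib_left mult_ac)

lemma outer_prod_mult_vec:
  fixes v :: "'a :: comm_semiring_0 vec"
  assumes "w \<in> carrier_vec n" "x \<in> carrier_vec n"
  shows "outer_prod v w *\<^sub>v x = (w \<bullet> x) \<cdot>\<^sub>v v"
  by (rule eq_vecI, insert assms, auto simp: scalar_prod_def sum_distrib_left mult_ac)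

lemma mult_smult_vec:
  fixes v :: "'a :: comm_semiring_0 vec"
  assumes "A \<in> carrier_mat m n" "v \<in> carrier_vec n"
  shows "A *\<^sub>v (c \<cdot>\<^sub>v v) = c \<cdot>\<^sub>v (A *\<^sub>v v)"
  by (rule eq_vecI, insert assms, auto simp: scalar_prod_def sum_distrib_left mult_ac)

lemma smult_mat_mult_vec:
  fixes v :: "'a :: comm_semiring_0 vec"
  assumes "A \<in> carrier_mat m n" "v \<in> carrier_vec n"
  shows "(c \<cdot>\<^sub>m A) *\<^sub>v v = c \<cdot>\<^sub>v (A *\<^sub>v v)"
  by (rule eq_vecI, insert assms, auto simp: scalar_prod_def sum_distrib_left mult_ac)

lemma vec_diff_eq_zeroD:
  fixes x y :: "'a :: group_add vec"
  assumes "x \<in> carrier_vec n" "y \<in> carrier_vec n" "x - y = 0\<^sub>v n"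
  shows "x = y"
proof (rule eq_vecI)
  fix i assume "i < dim_vec y"
  then show "x $ i = y $ i"
    using arg_cong[OF assms(3), of "\<lambda>z. z $ i"] assms(1,2) by simp
qed (use assms in auto)

section \<open>Stein equations over the complex numbers\<close>

text \<open>Schur decomposition. The form \<open>A * T = T * U\<close> suits recursions over the
  columns of a product with \<open>T\<close>; the diagonal of \<open>U\<close> consists of roots of
  the characteristic polynomial of \<open>A\<close>, so nonresonance applies to it.\<close>

lemma complex_mat_triangularize:
  fixes A :: "complex mat"
  assumes A: "A \<in> carrier_mat n n"
  obtains T T' U where "T \<in> carrier_mat n n" "T' \<in> carrier_mat n n" "U \<in> carrier_mat n n"
    "T * T' = 1\<^sub>m n" "T' * T = 1\<^sub>m n" "A * T = T * U"
    "\<And>i j. j < i \<Longrightarrow> i < n \<Longrightarrow> U $$ (i, j) = 0"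
    "\<And>i. i < n \<Longrightarrow> U $$ (i, i) \<in> spectrum A"
proof -
  obtain es where es: "char_poly A = (\<Prod>e\<leftarrow>es. [:- e, 1:])"
    using char_poly_factorized[OF A] by blast
  obtain U where U: "U \<in> carrier_mat n n" "upper_triangular U" "similar_mat A U"
    using schur_decomposition_exists[OF A es] by blast
  then obtain T T' where "similar_mat_wit A U T T'"
    unfolding similar_mat_def by blast
  note T = similar_mat_witD2[OF A this]
  have "A * T = T * U * (T' * T)"
    unfolding T(3) using T U by (simp add: assoc_mult_mat[of _ n n _ n _ n])
  then have AT: "A * T = T * U"
    using T U by simp
  have spec: "U $$ (i, i) \<in> spectrum A" if i: "i < n" for i
  proof -
    have "U $$ (i, i) \<in> set (diag_mat U)"
      using U i by (auto simp: diag_mat_def)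
    then have "poly (char_poly U) (U $$ (i, i)) = 0"
      unfolding char_poly_upper_triangular[OF U(1,2)]
      by (intro linear_poly_root)
    then show ?thesis
      using char_poly_similar[OF U(3)] spectrum_root_char_poly[OF A] by simp
  qed
  show thesis
    by (rule that[OF T(6,7) U(1) T(1,2) AT _ spec]) (use U in auto)
qed

text \<open>For \<open>c \<noteq> 0\<close> a nonzero \<open>z\<close> would be an eigenvector of
  \<open>A\<close> for \<open>1 / c\<close>, which nonresonance excludes; for \<open>c = 0\<close>
  the equation itself gives \<open>z = 0\<close>.\<close>

lemma nonresonant_vec_zero:
  fixes A :: "complex mat"
  assumes A: "A \<in> carrier_mat n n" and z: "z \<in> carrier_vec n"
    and eq: "z = c \<cdot>\<^sub>v (A *\<^sub>v z)"
    and nonres: "\<And>\<alpha>. \<alpha> \<in> spectrum A \<Longrightarrow> \<alpha> * c \<noteq> 1"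
  shows "z = 0\<^sub>v n"
proof (rule ccontr)
  assume z0: "z \<noteq> 0\<^sub>v n"
  have c: "c \<noteq> 0"
  proof
    assume "c = 0"
    then have "z = 0\<^sub>v n" by (subst eq, intro eq_vecI, use A in auto)
    then show False using z0 by simp
  qed
  have "A *\<^sub>v z = (1 / c) \<cdot>\<^sub>v (c \<cdot>\<^sub>v (A *\<^sub>v z))"
    using c by (simp add: smult_smult_assoc)
  then have "A *\<^sub>v z = (1 / c) \<cdot>\<^sub>v z" using eq by simp
  then have "1 / c \<in> spectrum A"
    using A z z0 unfolding spectrum_def eigenvalue_def eigenvector_def by auto
  from nonres[OF this] c show False by simp
qed

text \<open>A triangular form \<open>U\<close> of \<open>C\<close> turns the equation into
  \<open>Y = A * (Y * U)\<close> with \<open>Y = Z * T\<close>. Once the columns of \<open>Y\<close>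
  before \<open>j\<close> vanish, column \<open>j\<close> is fixed by \<open>A\<close> scaled with
  the \<open>j\<close>-th diagonal entry of \<open>U\<close>, so it vanishes by
  nonresonance.\<close>

lemma complex_stein_unique:
  fixes A C Z :: "complex mat"
  assumes A: "A \<in> carrier_mat n n" and C: "C \<in> carrier_mat m m" and Z: "Z \<in> carrier_mat n m"
    and nonres: "\<And>\<alpha> \<gamma>. \<alpha> \<in> spectrum A \<Longrightarrow> \<gamma> \<in> spectrum C \<Longrightarrow> \<alpha> * \<gamma> \<noteq> 1"
    and eq: "Z = A * Z * C"
  shows "Z = 0\<^sub>m n m"
proof -
  obtain T T' U where T: "T \<in> carrier_mat m m" "T' \<in> carrier_mat m m" "U \<in> carrier_mat m m"
    "T * T' = 1\<^sub>m m" "T' * T = 1\<^sub>m m" "C * T = T * U"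
    and tri: "\<And>i j. j < i \<Longrightarrow> i < m \<Longrightarrow> U $$ (i, j) = 0"
    and spec: "\<And>i. i < m \<Longrightarrow> U $$ (i, i) \<in> spectrum C"
    using complex_mat_triangularize[OF C] by blast
  define Y where "Y = Z * T"
  have Y: "Y \<in> carrier_mat n m" using Z T by (simp add: Y_def)
  have "Z * T = A * Z * C * T" using eq by simp
  also have "\<dots> = A * Z * (C * T)" using A Z C T(1)
    by (simp add: assoc_mult_mat[of _ n n _ m _ m] assoc_mult_mat[of _ n m _ m _ m])
  also have "\<dots> = A * (Y * U)"
    unfolding T(6) Y_def using A Z T(1,3)
    by (simp add: assoc_mult_mat[of _ n n _ m _ m] assoc_mult_mat[of _ n m _ m _ m])
  finally have YU: "Y = A * (Y * U)" unfolding Y_def .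
  have col0: "col Y j = 0\<^sub>v n" if "j < m" for j
    using that
  proof (induction j rule: less_induct)
    case (less j)
    have prev: "Y $$ (i, k) = 0" if "i < n" "k < j" for i k
    proof -
      have "Y $$ (i, k) = col Y k $ i" using that less.prems Y by simp
      then show ?thesis using that less by simp
    qed
    have "col (Y * U) j = U $$ (j, j) \<cdot>\<^sub>v col Y j"
    proof (rule eq_vecI)
      fix i assume "i < dim_vec (U $$ (j, j) \<cdot>\<^sub>v col Y j)"
      then have i: "i < n" using Y by simp
      have "col (Y * U) j $ i = (\<Sum>k\<in>{0..<m}. Y $$ (i, k) * U $$ (k, j))"
        using i less Y T by (simp add: scalar_prod_def)
      also have "\<dots> = (\<Sum>k\<in>{0..<m}. if k = j then Y $$ (i, j) * U $$ (j, j) else 0)"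
      proof (rule sum.cong)
        fix k assume "k \<in> {0..<m}"
        then show "Y $$ (i, k) * U $$ (k, j) = (if k = j then Y $$ (i, j) * U $$ (j, j) else 0)"
          using prev[OF i, of k] tri[of j k] by (cases k j rule: linorder_cases) auto
      qed simp
      also have "\<dots> = Y $$ (i, j) * U $$ (j, j)" using less by simp
      finally show "col (Y * U) j $ i = (U $$ (j, j) \<cdot>\<^sub>v col Y j) $ i"
        using i less Y by simp
    qed (use Y T in auto)
    moreover have "col Y j = A *\<^sub>v col (Y * U) j"
    proof -
      have "col Y j = col (A * (Y * U)) j" using YU by simp
      also have "\<dots> = A *\<^sub>v col (Y * U) j"
        by (rule col_mult2[of A n n _ m]) (use A Y T less in auto)
      finally show ?thesis .
    qed
    ultimately have "col Y j = U $$ (j, j) \<cdot>\<^sub>v (A *\<^sub>v col Y j)"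
      using mult_smult_vec[OF A, of "col Y j"] Y by (metis col_dim carrier_matD(1))
    then show ?case
      by (intro nonresonant_vec_zero[OF A]) (use Y nonres spec less in auto)
  qed
  have "Y = 0\<^sub>m n m"
  proof (rule eq_matI)
    fix i j assume "i < dim_row (0\<^sub>m n m :: complex mat)" "j < dim_col (0\<^sub>m n m :: complex mat)"
    then show "Y $$ (i, j) = 0\<^sub>m n m $$ (i, j)"
      using arg_cong[OF col0[of j], of "\<lambda>x. x $ i"] Y by simp
  qed (use Y in auto)
  moreover have "Z = Y * T'"
    unfolding Y_def using Z T by (simp add: assoc_mult_mat[of _ n m _ m _ m])
  ultimately show ?thesis using T by simp
qed

section \<open>Matrices commuting with \<open>A\<close> and their values at \<open>v\<close>\<close>

text \<open>Commuting with \<open>A\<close> is a linear condition and evaluation at \<open>v\<close>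
  is linear, so matrices realizing the columns of \<open>U\<close> at \<open>v\<close> combine to
  realize any vector in the column span of \<open>U\<close>.\<close>

lemma commuting_linear_combination:
  fixes A U :: "'a :: comm_semiring_0 mat"
  assumes A: "A \<in> carrier_mat n n" and v: "v \<in> carrier_vec n" and U: "U \<in> carrier_mat n n"
    and x: "x \<in> carrier_vec n"
    and F: "\<And>i. i < n \<Longrightarrow> F i \<in> carrier_mat n n" "\<And>i. i < n \<Longrightarrow> A * F i = F i * A"
      "\<And>i. i < n \<Longrightarrow> F i *\<^sub>v v = col U i"
  defines "M \<equiv> mat n n (\<lambda>(r, s). \<Sum>i\<in>{0..<n}. x $ i * F i $$ (r, s))"
  shows "A * M = M * A" "M *\<^sub>v v = U *\<^sub>v x"
proof -
  have M: "M \<in> carrier_mat n n" by (simp add: M_def)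
  have AF: "(\<Sum>k\<in>{0..<n}. A $$ (r, k) * F i $$ (k, s)) = (\<Sum>k\<in>{0..<n}. F i $$ (r, k) * A $$ (k, s))"
    if "i < n" "r < n" "s < n" for i r s
    using arg_cong[OF F(2)[OF that(1)], of "\<lambda>X. X $$ (r, s)"] F(1)[OF that(1)] A that
    by (simp add: scalar_prod_def)
  show "A * M = M * A"
  proof (rule eq_matI)
    fix r s assume "r < dim_row (M * A)" "s < dim_col (M * A)"
    then have rs: "r < n" "s < n" using A M by auto
    have "(A * M) $$ (r, s) = (\<Sum>k\<in>{0..<n}. \<Sum>i\<in>{0..<n}. x $ i * (A $$ (r, k) * F i $$ (k, s)))"
      using A M rs by (simp add: scalar_prod_def M_def sum_distrib_left mult_ac)
    also have "\<dots> = (\<Sum>i\<in>{0..<n}. x $ i * (\<Sum>k\<in>{0..<n}. A $$ (r, k) * F i $$ (k, s)))"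
      by (subst sum.swap) (simp add: sum_distrib_left)
    also have "\<dots> = (\<Sum>i\<in>{0..<n}. x $ i * (\<Sum>k\<in>{0..<n}. F i $$ (r, k) * A $$ (k, s)))"
      using AF rs by simp
    also have "\<dots> = (\<Sum>k\<in>{0..<n}. \<Sum>i\<in>{0..<n}. x $ i * (F i $$ (r, k) * A $$ (k, s)))"
      unfolding sum_distrib_left by (rule sum.swap)
    also have "\<dots> = (M * A) $$ (r, s)"
      using A M rs by (simp add: scalar_prod_def M_def sum_distrib_left sum_distrib_right mult_ac)
    finally show "(A * M) $$ (r, s) = (M * A) $$ (r, s)" .
  qed (use A M in auto)
  have Fv: "(\<Sum>k\<in>{0..<n}. F i $$ (r, k) * v $ k) = U $$ (r, i)" if "i < n" "r < n" for i r
    using arg_cong[OF F(3)[OF that(1)], of "\<lambda>X. X $ r"] F(1)[OF that(1)] U v that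
    by (simp add: scalar_prod_def)
  show "M *\<^sub>v v = U *\<^sub>v x"
  proof (rule eq_vecI)
    fix r assume "r < dim_vec (U *\<^sub>v x)"
    then have r: "r < n" using U by simp
    have "(M *\<^sub>v v) $ r = (\<Sum>k\<in>{0..<n}. \<Sum>i\<in>{0..<n}. x $ i * (F i $$ (r, k) * v $ k))"
      using v r by (simp add: scalar_prod_def M_def sum_distrib_left sum_distrib_right mult_ac)
    also have "\<dots> = (\<Sum>i\<in>{0..<n}. x $ i * (\<Sum>k\<in>{0..<n}. F i $$ (r, k) * v $ k))"
      by (subst sum.swap) (simp add: sum_distrib_left)
    also have "\<dots> = (U *\<^sub>v x) $ r"
      using Fv r U x by (simp add: scalar_prod_def mult_ac)
    finally show "(M *\<^sub>v v) $ r = (U *\<^sub>v x) $ r" .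
  qed (use U M in auto)
qed


text \<open>With \<open>M\<^sub>j\<close> the product of the first \<open>j\<close> factors \<open>A - \<alpha>\<^sub>i\<close> over the diagonal
  \<open>\<alpha>\<^sub>0, \<alpha>\<^sub>1, \<dots>\<close> of a triangular form of \<open>A\<close>, one has \<open>M\<^sub>n = 0\<close> (Cayley--Hamilton). If \<open>x\<close> is orthogonal
  to every \<open>M\<^sub>j v\<close>, then descending from \<open>j = n\<close> each \<open>M\<^sub>j\<^sup>T x\<close> is an eigenvector of \<open>A\<^sup>T\<close> orthogonal
  to \<open>v\<close> or zero, and the Stein equation excludes the former. So the \<open>M\<^sub>j v\<close> span the whole space.\<close>

lemma complex_commuting_exists:
  fixes A P :: "complex mat"
  assumes A: "A \<in> carrier_mat n n" and P: "P \<in> carrier_mat n n"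
    and v: "v \<in> carrier_vec n" and u: "u \<in> carrier_vec n"
    and nonres: "\<And>\<alpha> \<gamma>. \<alpha> \<in> spectrum A \<Longrightarrow> \<gamma> \<in> spectrum A \<Longrightarrow> \<alpha> * \<gamma> \<noteq> 1"
    and stein: "P - A * P * transpose_mat A = outer_prod v v"
    and det_P: "det P \<noteq> 0"
  obtains M where "M \<in> carrier_mat n n" "A * M = M * A" "M *\<^sub>v v = u"
proof -
  obtain T T' U where T: "T \<in> carrier_mat n n" "T' \<in> carrier_mat n n" "U \<in> carrier_mat n n"
    "T * T' = 1\<^sub>m n" "T' * T = 1\<^sub>m n" and AT: "A * T = T * U"
    and tri: "\<And>i j. j < i \<Longrightarrow> i < n \<Longrightarrow> U $$ (i, j) = 0"
    and spec: "\<And>i. i < n \<Longrightarrow> U $$ (i, i) \<in> spectrum A"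
    using complex_mat_triangularize[OF A] by blast
  define D where "D j = A - U $$ (j, j) \<cdot>\<^sub>m 1\<^sub>m n" for j
  have D: "D j \<in> carrier_mat n n" for j using A by (simp add: D_def)
  define M where "M = rec_nat (1\<^sub>m n) (\<lambda>j X. X * D j)"
  have M0: "M 0 = 1\<^sub>m n" and MSuc: "M (Suc j) = M j * D j" for j
    by (simp_all add: M_def)
  have M: "M j \<in> carrier_mat n n" for j
    by (induction j) (simp_all add: M0 MSuc D)
  have AD: "A * D j = D j * A" for j
    using A by (simp add: D_def mult_minus_distrib_mat[of _ n n _ n] minus_mult_distrib_mat[of _ n n _ _ n]
      mult_smult_distrib[of _ n n _ n] mult_smult_assoc_mat[of _ n n _ n])
  have AM: "A * M j = M j * A" for j
  proof (induction j)
    case 0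
    then show ?case using A by (simp add: M0)
  next
    case (Suc j)
    have "A * M (Suc j) = (A * M j) * D j"
      unfolding MSuc using A M D by (simp add: assoc_mult_mat[of _ n n _ n _ n])
    also have "\<dots> = M j * (A * D j)"
      unfolding Suc using A M D by (simp add: assoc_mult_mat[of _ n n _ n _ n])
    also have "\<dots> = M (Suc j) * A"
      unfolding MSuc AD using A M D by (simp add: assoc_mult_mat[of _ n n _ n _ n])
    finally show ?case .
  qed
  have DT: "D j * T = T * (U - U $$ (j, j) \<cdot>\<^sub>m 1\<^sub>m n)" for j
    using A T(1,3) by (simp add: D_def mult_minus_distrib_mat[of _ n n _ n] minus_mult_distrib_mat[of _ n n _ _ n]
      mult_smult_distrib[of _ n n _ n] mult_smult_assoc_mat[of _ n n _ n] AT)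
  \<comment> \<open>In the basis \<open>T\<close> the factor \<open>D j\<close> becomes upper
    triangular with a zero at position \<open>(j, j)\<close>, so each further factor kills one more
    leading column. For \<open>j = n\<close> all columns are gone.\<close>
  have MT: "(M j * T) $$ (r, i) = 0" if "i < j" "j \<le> n" "r < n" for i j r
    using that
  proof (induction j arbitrary: i)
    case (Suc j)
    let ?Y = "M j * T"
    have Y: "?Y \<in> carrier_mat n n" by (intro mult_carrier_mat[of _ n n] M T)
    have "M (Suc j) * T = M j * (D j * T)"
      unfolding MSuc using M D T(1) by (simp add: assoc_mult_mat[of _ n n _ n _ n])
    also have "\<dots> = ?Y * (U - U $$ (j, j) \<cdot>\<^sub>m 1\<^sub>m n)"
      unfolding DT using M T(1,3) by (simp add: assoc_mult_mat[of _ n n _ n _ n])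
    finally have "(M (Suc j) * T) $$ (r, i)
        = (\<Sum>k\<in>{0..<n}. ?Y $$ (r, k) * (U - U $$ (j, j) \<cdot>\<^sub>m 1\<^sub>m n) $$ (k, i))"
      using index_mult_mat_sum[OF Y, of "U - U $$ (j, j) \<cdot>\<^sub>m 1\<^sub>m n" n r i] T(3) Suc.prems by simp
    also have "\<dots> = 0"
    proof (rule sum.neutral, rule ballI)
      fix k assume "k \<in> {0..<n}"
      then have k: "k < n" by simp
      show "?Y $$ (r, k) * (U - U $$ (j, j) \<cdot>\<^sub>m 1\<^sub>m n) $$ (k, i) = 0"
      proof (cases "k < j")
        case True
        then have "?Y $$ (r, k) = 0" by (intro Suc.IH) (use Suc.prems in auto)
        then show ?thesis by simp
      next
        case False
        then have "(U - U $$ (j, j) \<cdot>\<^sub>m 1\<^sub>m n) $$ (k, i) = 0"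
          using Suc.prems k T tri[of i k] by (cases "k = j") auto
        then show ?thesis by simp
      qed
    qed
    finally show ?case .
  qed simp
  have "M n * T = 0\<^sub>m n n"
    by (rule eq_matI) (use MT[of _ n] M[of n] T(1) carrier_matD[OF M[of n]] in \<open>auto simp del: index_mult_mat(1)\<close>)
  moreover have "M n = M n * T * T'"
    using M[of n] T(1,2,4) by (simp add: assoc_mult_mat[of _ n n _ n _ n])
  ultimately have Mn: "M n = 0\<^sub>m n n" using T(2) by simp

  define C where "C = mat n n (\<lambda>(r, j). (M j *\<^sub>v v) $ r)"
  have C: "C \<in> carrier_mat n n" by (simp add: C_def)
  have colC: "M j *\<^sub>v v = col C j" if "j < n" for j
    by (rule eq_vecI) (use that M C_def in auto)
  have "det C \<noteq> 0"
  proof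
    assume "det C = 0"
    then have "det (transpose_mat C) = 0" using det_transpose[OF C] by simp
    then obtain x where x: "x \<in> carrier_vec n" "x \<noteq> 0\<^sub>v n" "transpose_mat C *\<^sub>v x = 0\<^sub>v n"
      using det_0_iff_vec_prod_zero[of "transpose_mat C" n] C by auto
    have orth: "(M j *\<^sub>v v) \<bullet> x = 0" if "j < n" for j
      using arg_cong[OF x(3), of "\<lambda>y. y $ j"] that C colC by simp
    define y where "y j = transpose_mat (M j) *\<^sub>v x" for j
    have y: "y j \<in> carrier_vec n" for j
      unfolding y_def using M x(1) by (intro mult_mat_vec_carrier[of _ n n]) auto
    have "y j = 0\<^sub>v n" if "j \<le> n" for j
      using that
    proof (induction j rule: inc_induct)
      case base
      show ?case using x(1) by (auto simp: y_def Mn intro!: eq_vecI)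
    next
      case (step j)
      have DTr: "transpose_mat (D j) = transpose_mat A - U $$ (j, j) \<cdot>\<^sub>m 1\<^sub>m n"
        by (rule eq_matI) (use A in \<open>auto simp: D_def\<close>)
      have "transpose_mat (D j) *\<^sub>v y j = y (Suc j)"
        using M D x(1) unfolding y_def MSuc
        by (simp add: transpose_mult[of _ n n _ n] assoc_mult_mat_vec[of _ n n _ n])
      then have "transpose_mat A *\<^sub>v y j - U $$ (j, j) \<cdot>\<^sub>v y j = 0\<^sub>v n"
        using A y[of j] unfolding step(3) DTr
        by (simp add: minus_mult_distrib_mat_vec[of _ n n] smult_mat_mult_vec[of _ n n])
      then have Ay: "transpose_mat A *\<^sub>v y j = U $$ (j, j) \<cdot>\<^sub>v y j"
        by (rule vec_diff_eq_zeroD[rotated 2]) (use A y in auto)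
      have vy: "v \<bullet> y j = 0"
      proof -
        have "y j \<bullet> v = x \<bullet> (M j *\<^sub>v v)"
          unfolding y_def by (rule transpose_vec_mult_scalar[OF M v x(1)])
        also have "\<dots> = 0"
          using orth[OF step(2)] x(1) M[of j] v by (subst comm_scalar_prod[of _ n]) auto
        finally show ?thesis using v y by (subst comm_scalar_prod[of _ n]) auto
      qed
      \<comment> \<open>As \<open>v\<close> is orthogonal to the vector \<open>y j\<close>, applying
        the Stein equation to it leaves a homogeneous relation; the relation \<open>Ay\<close> then
        makes \<open>P *\<^sub>v y j\<close> a vector to which \<open>nonresonant_vec_zero\<close>
        applies.\<close>
      have "P *\<^sub>v y j - A *\<^sub>v (P *\<^sub>v (transpose_mat A *\<^sub>v y j)) = outer_prod v v *\<^sub>v y j"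
        unfolding stein[symmetric] using A P y[of j]
        by (simp add: minus_mult_distrib_mat_vec[of _ n n] assoc_mult_mat_vec[of _ n n _ n])
      also have "\<dots> = 0\<^sub>v n"
        using v vy y[of j] by (simp add: outer_prod_mult_vec) (auto intro: eq_vecI)
      finally have "P *\<^sub>v y j = A *\<^sub>v (P *\<^sub>v (transpose_mat A *\<^sub>v y j))"
        by (rule vec_diff_eq_zeroD[rotated 2]) (use A P y[of j] in auto)
      then have "P *\<^sub>v y j = U $$ (j, j) \<cdot>\<^sub>v (A *\<^sub>v (P *\<^sub>v y j))"
        unfolding Ay using A P y[of j]
        by (simp add: mult_smult_vec[of _ n n])
      then have "P *\<^sub>v y j = 0\<^sub>v n"
        by (intro nonresonant_vec_zero[OF A]) (use P y nonres spec step in auto)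
      then show ?case using det_0_iff_vec_prod_zero[OF P] det_P y by blast
    qed
    from this[of 0] x show False by (simp add: y_def M0)
  qed
  then obtain C' where C': "C' \<in> carrier_mat n n" "C * C' = 1\<^sub>m n"
    using det_non_zero_imp_unit[OF C] unfolding Units_def ring_mat_def by auto
  \<comment> \<open>Since \<open>C * C' = 1\<close>, the entries of \<open>C' *\<^sub>v u\<close>
    are the coordinates of \<open>u\<close> in the basis of the vectors
    \<open>M j *\<^sub>v v\<close>.\<close>
  note comb = commuting_linear_combination[OF A v C _ M AM colC, of "C' *\<^sub>v u"]
  show thesis
  proof (rule that)
    show "mat n n (\<lambda>(r, s). \<Sum>i = 0..<n. (C' *\<^sub>v u) $ i * M i $$ (r, s)) \<in> carrier_mat n n" by simp
  qed (use comb C C' u in \<open>auto simp: assoc_mult_mat_vec[of C n n C' n u, symmetric]\<close>)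
qed

section \<open>Traces\<close>

definition mtrace :: "'a :: comm_ring_1 mat \<Rightarrow> 'a" where
  "mtrace X = (\<Sum>i\<in>{0..<dim_row X}. X $$ (i, i))"

lemma mtrace_mult_comm:
  assumes "X \<in> carrier_mat m n" "Y \<in> carrier_mat n m"
  shows "mtrace (X * Y) = mtrace (Y * X)"
proof -
  have "mtrace (X * Y) = (\<Sum>i\<in>{0..<m}. \<Sum>k\<in>{0..<n}. X $$ (i, k) * Y $$ (k, i))"
    using assms by (simp add: mtrace_def scalar_prod_def)
  also have "\<dots> = (\<Sum>k\<in>{0..<n}. \<Sum>i\<in>{0..<m}. Y $$ (k, i) * X $$ (i, k))"
    by (subst sum.swap) (simp add: mult.commute)
  also have "\<dots> = mtrace (Y * X)"
    using assms by (simp add: mtrace_def scalar_prod_def)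
  finally show ?thesis .
qed

lemma mtrace_add:
  "X \<in> carrier_mat n n \<Longrightarrow> Y \<in> carrier_mat n n \<Longrightarrow> mtrace (X + Y) = mtrace X + mtrace Y"
  by (auto simp: mtrace_def sum.distrib)

lemma mtrace_minus:
  "X \<in> carrier_mat n n \<Longrightarrow> Y \<in> carrier_mat n n \<Longrightarrow> mtrace (X - Y) = mtrace X - mtrace Y"
  by (auto simp: mtrace_def sum_subtractf)

lemma mtrace_smult: "X \<in> carrier_mat n n \<Longrightarrow> mtrace (c \<cdot>\<^sub>m X) = c * mtrace X"
  by (auto simp: mtrace_def sum_distrib_left)

lemma mtrace_outer_prod:
  "v \<in> carrier_vec n \<Longrightarrow> w \<in> carrier_vec n \<Longrightarrow> mtrace (outer_prod v w) = v \<bullet> w"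
  by (auto simp: mtrace_def scalar_prod_def)

section \<open>Elementary rules for scalars, zero and differences\<close>

lemma transpose_smult: "transpose_mat (c \<cdot>\<^sub>m A) = c \<cdot>\<^sub>m transpose_mat A"
  by (rule eq_matI) auto

lemma mult_mat_vec_zero:
  fixes A :: "'a :: semiring_0 mat"
  assumes "A \<in> carrier_mat m n"
  shows "A *\<^sub>v 0\<^sub>v n = 0\<^sub>v m"
  by (rule eq_vecI) (use assms in auto)

lemma smult_vec_eq_zero:
  fixes v :: "'a :: idom vec"
  assumes "v \<noteq> 0\<^sub>v n" "v \<in> carrier_vec n" "c \<cdot>\<^sub>v v = 0\<^sub>v n"
  shows "c = 0"
proof -
  obtain i where "i < n" "v $ i \<noteq> 0"
    using assms(1,2) by (metis carrier_vecD eq_vecI index_zero_vec)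
  then show ?thesis
    using arg_cong[OF assms(3), of "\<lambda>z. z $ i"] assms(2) by simp
qed

lemma mat_add_eqD:
  fixes X Y Z :: "'a :: ab_group_add mat"
  assumes "X \<in> carrier_mat m n" "Y \<in> carrier_mat m n" "Z = X + Y"
  shows "X = Z - Y"
  unfolding assms(3) by (rule eq_matI) (use assms(1,2) in auto)

lemma mat_diff_eqD:
  fixes X Y Z :: "'a :: ab_group_add mat"
  assumes "X \<in> carrier_mat m n" "Y \<in> carrier_mat m n" "Z = X - Y"
  shows "Y = X - Z"
  unfolding assms(3) by (rule eq_matI) (use assms(1,2) in auto)

lemma outer_prod_smult:
  fixes v :: "'a :: comm_semiring_0 vec"
  shows "outer_prod (c \<cdot>\<^sub>v v) w = c \<cdot>\<^sub>m outer_prod v w"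
    "outer_prod v (c \<cdot>\<^sub>v w) = c \<cdot>\<^sub>m outer_prod v w"
  by (auto intro!: eq_matI simp: mult_ac)

section \<open>Completion of a Stein pair\<close>

context
  fixes n :: nat
begin

text \<open>The matrix laws have carrier premises with free intermediate dimensions; fixing them all
  to \<open>n\<close> lets the simplifier discharge these. Products become right-associated and
  expanded, transposes move inward, and rank-one factors absorb their neighbours.\<close>

lemmas square_mat_simps =
  assoc_mult_mat[of _ n n _ n _ n] add_mult_distrib_mat[of _ n n _ _ n] mult_add_distrib_mat[of _ n n _ n]
  minus_mult_distrib_mat[of _ n n _ _ n] mult_minus_distrib_mat[of _ n n _ n]
  mult_smult_distrib[of _ n n _ n] mult_smult_assoc_mat[of _ n n _ n]
  transpose_mult[of _ n n _ n] transpose_add[of _ n n] transpose_minus[of _ n n]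
  transpose_smult transpose_outer_prod
  mult_outer_prod[of _ n n] outer_prod_mult[of _ n n] outer_prod_mult_vec[of _ n]
  assoc_mult_mat_vec[of _ n n _ n] add_mult_distrib_mat_vec[of _ n n] mult_add_distrib_mat_vec[of _ n n]
  minus_mult_distrib_mat_vec[of _ n n] mult_minus_distrib_mat_vec[of _ n n]
  mult_smult_vec[of _ n n] smult_mat_mult_vec[of _ n n]
  mult_carrier_mat[of _ n n _ n] mult_mat_vec_carrier[of _ n n]

lemma mat_inverse_exists:
  fixes X :: "'a :: field mat"
  assumes X: "X \<in> carrier_mat n n" and det: "det X \<noteq> 0"
  obtains Y where "Y \<in> carrier_mat n n" "X * Y = 1\<^sub>m n" "Y * X = 1\<^sub>m n"
  using det_non_zero_imp_unit[OF X det] X unfolding Units_def ring_mat_def by auto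

lemma det_nonzeroI:
  fixes X :: "'a :: field mat"
  assumes X: "X \<in> carrier_mat n n" and ker: "\<And>x. x \<in> carrier_vec n \<Longrightarrow> X *\<^sub>v x = 0\<^sub>v n \<Longrightarrow> x = 0\<^sub>v n"
  shows "det X \<noteq> 0"
  using det_0_iff_vec_prod_zero[OF X] ker by blast

text \<open>Comparing one row whose index \<open>i\<close> has \<open>x $ i \<noteq> 0\<close>
  determines \<open>y\<close>. This turns a symmetric rank-one matrix into a scalar multiple of
  \<open>outer_prod x x\<close>.\<close>

lemma symmetric_outer_prod:
  fixes x y :: "'a :: field vec"
  assumes x: "x \<in> carrier_vec n" "x \<noteq> 0\<^sub>v n" and y: "y \<in> carrier_vec n"
    and sym: "outer_prod x y = outer_prod y x"
  obtains s where "y = s \<cdot>\<^sub>v x"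
proof -
  from x obtain i where i: "i < n" "x $ i \<noteq> 0"
    by (metis carrier_vecD eq_vecI index_zero_vec)
  have "y = (y $ i / x $ i) \<cdot>\<^sub>v x"
  proof (rule eq_vecI)
    fix j assume "j < dim_vec ((y $ i / x $ i) \<cdot>\<^sub>v x)"
    then have j: "j < n" using x by simp
    have "x $ i * y $ j = y $ i * x $ j"
      using arg_cong[OF sym, of "\<lambda>Z. Z $$ (i, j)"] x y i j by simp
    then show "y $ j = ((y $ i / x $ i) \<cdot>\<^sub>v x) $ j"
      using i j x by (simp add: field_simps)
  qed (use x y in auto)
  then show thesis by (rule that)
qed

text \<open>The block matrix \<open>W = [B, m; w\<^sup>T, d]\<close> satisfies \<open>W diag(Q\<^sup>-\<^sup>1, s) W\<^sup>T = diag(Q\<^sup>-\<^sup>1, 1)\<close>.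
  If \<open>B\<close> is invertible, one can take \<open>m = B Q\<^sup>-\<^sup>1 w\<close>; otherwise
  \<open>w \<bullet> Q\<^sup>-\<^sup>1 w = 1\<close>, and the defect has rank one because a rank-one change of \<open>B\<close> is invertible.\<close>

lemma stein_completion:
  fixes Q Qi B :: "'a :: field mat" and w :: "'a vec"
  assumes Q: "Q \<in> carrier_mat n n" and Qi: "Qi \<in> carrier_mat n n" and B: "B \<in> carrier_mat n n"
    and w: "w \<in> carrier_vec n"
    and QQi: "Q * Qi = 1\<^sub>m n" and QiQ: "Qi * Q = 1\<^sub>m n" and sym: "transpose_mat Qi = Qi"
    and stein: "transpose_mat B * Q * B = Q - outer_prod w w"
  obtains s m d where "m \<in> carrier_vec n" "s \<noteq> 0"
    "B * Qi * transpose_mat B = Qi - s \<cdot>\<^sub>m outer_prod m m"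
    "B *\<^sub>v (Qi *\<^sub>v w) = (- s * d) \<cdot>\<^sub>v m" "w \<bullet> (Qi *\<^sub>v w) = 1 - s * d * d"
proof -
  define g where "g = Qi *\<^sub>v w"
  define Bt where "Bt = transpose_mat B"
  have g: "g \<in> carrier_vec n" using Qi w by (simp add: g_def)
  have Bt: "Bt \<in> carrier_mat n n" using B by (simp add: Bt_def)
  have Qg: "Q *\<^sub>v g = w"
    using Q Qi w QQi unfolding g_def by (simp add: assoc_mult_mat_vec[of _ n n _ n, symmetric])
  have BQB: "Bt * (Q * B) = Q - outer_prod w w"
    using stein Q B Bt unfolding Bt_def[symmetric] by (simp add: square_mat_simps)
  note carr = Q Qi B Bt w g
  show thesis
  proof (cases "w \<bullet> g = 1")
    case False
    define \<delta> where "\<delta> = 1 - w \<bullet> g"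
    have \<delta>: "\<delta> \<noteq> 0" "w \<bullet> g = 1 - \<delta>" using False by (auto simp: \<delta>_def)
    \<comment> \<open>The Sherman-Morrison inverse of \<open>Q - outer_prod w w\<close>, which
      equals \<open>Bt * (Q * B)\<close>. One-sided inverses of square matrices are two-sided, so
      the factors can be rotated until \<open>B * H * Bt = Qi\<close> remains.\<close>
    define H where "H = Qi + (1 / \<delta>) \<cdot>\<^sub>m outer_prod g g"
    have H: "H \<in> carrier_mat n n" using carr by (simp add: H_def)
    have "(Q - outer_prod w w) * H = 1\<^sub>m n"
    proof -
      have "(Q - outer_prod w w) * H = 1\<^sub>m n - outer_prod w g
          + (1 / \<delta>) \<cdot>\<^sub>m outer_prod w g - (1 / \<delta>) \<cdot>\<^sub>m ((1 - \<delta>) \<cdot>\<^sub>m outer_prod w g)"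
        using carr QQi \<delta>(2) comm_scalar_prod[OF g w] sym
        by (simp add: H_def square_mat_simps outer_prod_smult Qg g_def[symmetric])
          (auto intro!: eq_matI simp: algebra_simps)
      also have "\<dots> = 1\<^sub>m n"
        by (rule eq_matI) (use carr \<delta> in \<open>auto simp: field_simps\<close>)
      finally show ?thesis .
    qed
    then have "Bt * (Q * (B * H)) = 1\<^sub>m n"
      unfolding BQB[symmetric] using carr H by (simp add: square_mat_simps)
    then have "Q * (B * H) * Bt = 1\<^sub>m n"
      by (rule mat_mult_left_right_inverse[rotated 2]) (use carr H in \<open>simp_all add: square_mat_simps\<close>)
    then have "Qi * (Q * (B * H) * Bt) = Qi" using Qi by simp
    also have "Qi * (Q * (B * H) * Bt) = (Qi * Q) * (B * H * Bt)"
      using carr H by (simp add: square_mat_simps)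
    finally have BHB: "B * H * Bt = Qi" using carr H QiQ by (simp add: square_mat_simps)
    \<comment> \<open>With \<open>s = 1 / \<delta>\<close> and \<open>d = - \<delta>\<close> one has
      \<open>- s * d = 1\<close> and \<open>s * d * d = \<delta>\<close>.\<close>
    show thesis
    proof (rule that[of "B *\<^sub>v g" "1 / \<delta>" "- \<delta>"])
      have "B * H * Bt = B * Qi * Bt + (1 / \<delta>) \<cdot>\<^sub>m outer_prod (B *\<^sub>v g) (B *\<^sub>v g)"
        using carr unfolding H_def Bt_def by (simp add: square_mat_simps)
      then show "B * Qi * transpose_mat B = Qi - (1 / \<delta>) \<cdot>\<^sub>m outer_prod (B *\<^sub>v g) (B *\<^sub>v g)"
        unfolding BHB Bt_def[symmetric]
        by (rule mat_add_eqD[of _ n n, rotated 2]) (use carr in \<open>simp_all add: square_mat_simps\<close>)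
    qed (use carr \<delta> in \<open>auto simp: g_def[symmetric] field_simps\<close>)
  next
    case True
    \<comment> \<open>\<open>C\<close> is the adjoint of \<open>B\<close> for the bilinear form
      \<open>Q\<close>. Here \<open>C * B\<close> is the projection along \<open>g\<close>, while
      \<open>N\<close> measures the failure of \<open>B * C = 1\<close> and satisfies
      \<open>N * Qi = Qi - B * Qi * Bt\<close>, the defect to be computed.\<close>
    define C where "C = Qi * (Bt * Q)"
    define N where "N = 1\<^sub>m n - B * C"
    have C: "C \<in> carrier_mat n n" and N: "N \<in> carrier_mat n n"
      using carr by (simp_all add: C_def N_def square_mat_simps)
    have CB: "C * B = 1\<^sub>m n - outer_prod g w"
    proof -
      have "C * B = Qi * (Bt * (Q * B))" using carr by (simp add: C_def square_mat_simps)
      also have "\<dots> = 1\<^sub>m n - outer_prod g w"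
        unfolding BQB g_def using carr QiQ by (simp add: square_mat_simps)
      finally show ?thesis .
    qed
    have g0: "g \<noteq> 0\<^sub>v n"
      using True w by auto
    have kerB: "x = (w \<bullet> x) \<cdot>\<^sub>v g" if x: "x \<in> carrier_vec n" "B *\<^sub>v x = 0\<^sub>v n" for x
    proof -
      have "C *\<^sub>v (B *\<^sub>v x) = (C * B) *\<^sub>v x" using carr C x(1) by (simp add: square_mat_simps)
      also have "\<dots> = x - (w \<bullet> x) \<cdot>\<^sub>v g"
        unfolding CB using carr x(1) by (simp add: square_mat_simps)
      finally have "C *\<^sub>v (B *\<^sub>v x) = x - (w \<bullet> x) \<cdot>\<^sub>v g" .
      then have "x - (w \<bullet> x) \<cdot>\<^sub>v g = 0\<^sub>v n" using x(2) C by (simp add: mult_mat_vec_zero[of _ n n])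
      then show ?thesis by (rule vec_diff_eq_zeroD[rotated 2]) (use x carr in auto)
    qed
    \<comment> \<open>Otherwise \<open>B *\<^sub>v g\<close> is a nonzero kernel vector of
      \<open>Bt * Q\<close>, so \<open>B\<close> is singular; but by \<open>kerB\<close> every
      kernel vector of \<open>B\<close> is a multiple of \<open>g\<close>, and a nonzero one puts
      \<open>g\<close> itself into the kernel.\<close>
    have Bg: "B *\<^sub>v g = 0\<^sub>v n"
    proof (rule ccontr)
      assume Bg: "B *\<^sub>v g \<noteq> 0\<^sub>v n"
      have "Bt * Q *\<^sub>v (B *\<^sub>v g) = 0\<^sub>v n"
      proof -
        have "Bt * Q *\<^sub>v (B *\<^sub>v g) = (Bt * (Q * B)) *\<^sub>v g"
          using carr by (simp add: square_mat_simps)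
        also have "\<dots> = 0\<^sub>v n"
          unfolding BQB using carr True by (simp add: square_mat_simps Qg)
        finally show ?thesis .
      qed
      then have "det (Bt * Q) = 0"
        using det_0_iff_vec_prod_zero[OF mult_carrier_mat[OF Bt Q]] Bg mult_mat_vec_carrier[OF B g]
        by blast
      moreover have "det Q \<noteq> 0"
        using det_mult[OF Q Qi] QQi by auto
      ultimately have "det B = 0"
        using det_mult[OF Bt Q] det_transpose[OF B] by (simp add: Bt_def)
      then obtain x where x: "x \<in> carrier_vec n" "x \<noteq> 0\<^sub>v n" "B *\<^sub>v x = 0\<^sub>v n"
        using det_0_iff_vec_prod_zero[OF B] by blast
      note xg = kerB[OF x(1,3)]
      have "0\<^sub>v n = B *\<^sub>v ((w \<bullet> x) \<cdot>\<^sub>v g)" using x(3) xg by metis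
      also have "\<dots> = (w \<bullet> x) \<cdot>\<^sub>v (B *\<^sub>v g)" using carr by (simp add: square_mat_simps)
      finally have "w \<bullet> x = 0"
        using smult_vec_eq_zero[OF Bg] carr by (metis mult_mat_vec_carrier)
      then have "x = 0 \<cdot>\<^sub>v g" using xg by metis
      then show False using x(2) g by auto
    qed
    have NB: "N * B = 0\<^sub>m n n"
    proof -
      have "N * B = B - B * (C * B)" using carr C by (simp add: N_def square_mat_simps)
      also have "\<dots> = B - (B - outer_prod (0\<^sub>v n) w)"
        unfolding CB using carr by (simp add: square_mat_simps Bg)
      also have "\<dots> = 0\<^sub>m n n" by (rule eq_matI) (use carr in auto)
      finally show ?thesis .
    qed
    have "N \<noteq> 0\<^sub>m n n"
    proof
      assume N0: "N = 0\<^sub>m n n"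
      have "B * C = 1\<^sub>m n - N"
        by (rule mat_diff_eqD[of _ n n, OF _ _ N_def]) (use carr C in \<open>simp_all add: square_mat_simps\<close>)
      then have "B * C = 1\<^sub>m n" unfolding N0 by (auto intro!: eq_matI)
      then have "C * B = 1\<^sub>m n"
        by (rule mat_mult_left_right_inverse[OF B C])
      then have "C * B *\<^sub>v g = g" using g by simp
      moreover have "C * B *\<^sub>v g = g - (w \<bullet> g) \<cdot>\<^sub>v g"
        unfolding CB using carr by (simp add: square_mat_simps)
      moreover have "g - (w \<bullet> g) \<cdot>\<^sub>v g = 0\<^sub>v n" using True g by simp
      ultimately have "g = 0\<^sub>v n" by metis
      then show False using g0 by simp
    qed
    then obtain k where k: "k \<in> carrier_vec n" "N *\<^sub>v k \<noteq> 0\<^sub>v n"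
    proof -
      from \<open>N \<noteq> 0\<^sub>m n n\<close> obtain i j where ij: "i < n" "j < n" "N $$ (i, j) \<noteq> 0"
        using N eq_matI[of "0\<^sub>m n n" N] by auto
      have "(N *\<^sub>v unit_vec n j) $ i = N $$ (i, j)"
        using N ij by simp
      then have "N *\<^sub>v unit_vec n j \<noteq> 0\<^sub>v n" using ij by auto
      then show thesis by (intro that[of "unit_vec n j"]) auto
    qed
    define x where "x = N *\<^sub>v k"
    have x: "x \<in> carrier_vec n" "x \<noteq> 0\<^sub>v n" using k N by (auto simp: x_def)
    \<comment> \<open>The perturbation moves the kernel of \<open>B\<close> away, so
      \<open>B'\<close> is invertible, while \<open>N * B = 0\<close> leaves \<open>N * B'\<close>
      of rank one. Cancelling \<open>B'\<close> shows that \<open>N\<close>, and hence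
      \<open>N * Qi\<close>, has rank one.\<close>
    define B' where "B' = B + outer_prod k w"
    have B': "B' \<in> carrier_mat n n" using carr k by (simp add: B'_def)
    have NB': "N * B' = outer_prod x w"
      using carr k N x NB by (simp add: B'_def square_mat_simps x_def)
    have "det B' \<noteq> 0"
    proof (rule det_nonzeroI[OF B'])
      fix z assume z: "z \<in> carrier_vec n" "B' *\<^sub>v z = 0\<^sub>v n"
      have "0\<^sub>v n = (N * B') *\<^sub>v z" using N B' z by (simp add: square_mat_simps mult_mat_vec_zero[of _ n n])
      also have "\<dots> = (w \<bullet> z) \<cdot>\<^sub>v x"
        unfolding NB' using carr x z by (simp add: square_mat_simps)
      finally have wz: "w \<bullet> z = 0"
        using smult_vec_eq_zero[OF x(2,1)] by metis
      have "B' *\<^sub>v z = B *\<^sub>v z + (w \<bullet> z) \<cdot>\<^sub>v k"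
        using carr k z by (simp add: B'_def square_mat_simps)
      then have "B *\<^sub>v z = 0\<^sub>v n" using wz z k carr by auto
      from kerB[OF z(1) this] wz have "z = 0 \<cdot>\<^sub>v g" by metis
      then show "z = 0\<^sub>v n" using g by auto
    qed
    then obtain Bi where Bi: "Bi \<in> carrier_mat n n" "B' * Bi = 1\<^sub>m n"
      using mat_inverse_exists[OF B'] by blast
    define y where "y = Qi *\<^sub>v (transpose_mat Bi *\<^sub>v w)"
    have y: "y \<in> carrier_vec n" using Bi carr by (simp add: y_def square_mat_simps)
    have NQi: "N * Qi = outer_prod x y"
    proof -
      have "N * Qi = (N * B') * (Bi * Qi)"
      proof -
        have "(N * B') * (Bi * Qi) = N * ((B' * Bi) * Qi)"
          using N B' Bi(1) carr by (simp add: square_mat_simps)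
        then show ?thesis using Bi carr by simp
      qed
      also have "\<dots> = outer_prod x y"
        unfolding NB' y_def using carr x Bi(1) by (simp add: square_mat_simps sym)
      finally show ?thesis .
    qed
    have J: "N * Qi = Qi - B * Qi * Bt"
    proof -
      have "N * Qi = Qi - B * Qi * Bt * (Q * Qi)"
        using carr unfolding N_def C_def by (simp add: square_mat_simps)
      then show ?thesis using carr QQi by (simp add: square_mat_simps)
    qed
    have "transpose_mat (N * Qi) = N * Qi"
      unfolding J using carr by (simp add: Bt_def square_mat_simps sym)
    then have "outer_prod x y = outer_prod y x"
      unfolding NQi by (simp add: transpose_outer_prod)
    then obtain s where s: "y = s \<cdot>\<^sub>v x"
      using symmetric_outer_prod[OF x y] by blast
    \<comment> \<open>The value \<open>d = 0\<close> matches \<open>B *\<^sub>v g = 0\<close> and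
      \<open>w \<bullet> g = 1\<close>.\<close>
    show thesis
    proof (rule that[of x s 0])
      show "s \<noteq> 0"
      proof
        assume "s = 0"
        then have "N * Qi = 0\<^sub>m n n" unfolding NQi s using x by (auto intro!: eq_matI)
        then have "N * (Qi * Q) = 0\<^sub>m n n"
          using carr N by (simp add: assoc_mult_mat[of _ n n _ n _ n, symmetric])
        then have "N = 0\<^sub>m n n" using QiQ N by simp
        then show False using \<open>N \<noteq> 0\<^sub>m n n\<close> by simp
      qed
      have "outer_prod x y = Qi - B * Qi * Bt" using NQi J by metis
      then have "s \<cdot>\<^sub>m outer_prod x x = Qi - B * Qi * Bt"
        unfolding s outer_prod_smult .
      then show "B * Qi * transpose_mat B = Qi - s \<cdot>\<^sub>m outer_prod x x"
        unfolding Bt_def[symmetric]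
        by (rule mat_diff_eqD[of Qi n n, rotated 2]) (use carr in \<open>simp_all add: square_mat_simps\<close>)
      show "B *\<^sub>v (Qi *\<^sub>v w) = (- s * 0) \<cdot>\<^sub>v x"
        using Bg x unfolding g_def by auto
      show "w \<bullet> (Qi *\<^sub>v w) = 1 - s * 0 * 0" using True by (simp add: g_def)
    qed (rule x)
  qed
qed

text \<open>Multiply the block identity \<open>W diag(Qi, s) W^T = diag(Qi, 1)\<close> by the row
  \<open>[T, u]\<close> on the left and its transpose on the right:
  \<open>[T, u] W = [T B + u w^T, T m + d u]\<close>. Suitable \<open>T\<close> and \<open>u\<close>
  turn the first block into \<open>A\<close> or into \<open>R\<close>.\<close>

lemma completed_congruence:
  fixes Qi B T :: "'a :: field mat"
  assumes Qi: "Qi \<in> carrier_mat n n" and B: "B \<in> carrier_mat n n" and T: "T \<in> carrier_mat n n"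
    and w: "w \<in> carrier_vec n" and m: "m \<in> carrier_vec n" and u: "u \<in> carrier_vec n"
    and sym: "transpose_mat Qi = Qi"
    and BQiB: "B * Qi * transpose_mat B = Qi - s \<cdot>\<^sub>m outer_prod m m"
    and Bg: "B *\<^sub>v (Qi *\<^sub>v w) = (- s * d) \<cdot>\<^sub>v m" and wg: "w \<bullet> (Qi *\<^sub>v w) = 1 - s * d * d"
  shows "(T * B + outer_prod u w) * Qi * transpose_mat (T * B + outer_prod u w)
    = T * Qi * transpose_mat T + outer_prod u u
      - s \<cdot>\<^sub>m outer_prod (T *\<^sub>v m + d \<cdot>\<^sub>v u) (T *\<^sub>v m + d \<cdot>\<^sub>v u)"
proof -
  define g where "g = Qi *\<^sub>v w"
  define Tt where "Tt = transpose_mat T"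
  define Bt where "Bt = transpose_mat B"
  have g: "g \<in> carrier_vec n" and Tt: "Tt \<in> carrier_mat n n" and Bt: "Bt \<in> carrier_mat n n"
    using Qi w T B by (simp_all add: g_def Tt_def Bt_def)
  note carr = Qi B T w m u g Tt Bt
  have BQB: "B * (Qi * Bt) = Qi - s \<cdot>\<^sub>m outer_prod m m"
    using BQiB carr by (simp add: Bt_def square_mat_simps)
  have tr: "transpose_mat (T * B + outer_prod u w) = Bt * Tt + outer_prod w u"
    using carr by (simp add: Tt_def Bt_def square_mat_simps)
  have TB: "T * B * Qi * (Bt * Tt) = T * Qi * Tt - s \<cdot>\<^sub>m outer_prod (T *\<^sub>v m) (T *\<^sub>v m)"
  proof -
    have "T * B * Qi * (Bt * Tt) = T * ((B * (Qi * Bt)) * Tt)"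
      using carr by (simp add: square_mat_simps)
    then show ?thesis
      unfolding BQB using carr by (simp add: square_mat_simps Tt_def)
  qed
  have TBw: "T * B * Qi * outer_prod w u = (- s * d) \<cdot>\<^sub>m outer_prod (T *\<^sub>v m) u"
    using carr Bg by (simp add: square_mat_simps g_def[symmetric] outer_prod_smult)
  have wTB: "outer_prod u w * Qi * (Bt * Tt) = (- s * d) \<cdot>\<^sub>m outer_prod u (T *\<^sub>v m)"
    using carr Bg by (simp add: square_mat_simps sym Bt_def Tt_def g_def[symmetric] outer_prod_smult)
  have ww: "outer_prod u w * Qi * outer_prod w u = (1 - s * d * d) \<cdot>\<^sub>m outer_prod u u"
  proof -
    have "outer_prod u w * Qi * outer_prod w u = outer_prod (outer_prod u w *\<^sub>v (Qi *\<^sub>v w)) u"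
      using carr by (simp add: mult_outer_prod[of _ n n] square_mat_simps(1) del: assoc_mult_mat)
    then show ?thesis
      using carr wg by (simp add: square_mat_simps outer_prod_smult)
  qed
  have "(T * B + outer_prod u w) * Qi * (Bt * Tt + outer_prod w u)
    = T * B * Qi * (Bt * Tt) + T * B * Qi * outer_prod w u
      + (outer_prod u w * Qi * (Bt * Tt) + outer_prod u w * Qi * outer_prod w u)"
  proof -
    have eq: "(X + Y) * Qi * (V + W) = X * Qi * V + X * Qi * W + (Y * Qi * V + Y * Qi * W)"
      if "X \<in> carrier_mat n n" "Y \<in> carrier_mat n n" "V \<in> carrier_mat n n" "W \<in> carrier_mat n n" for X Y V W
      using that Qi by (simp add: add_mult_distrib_mat[of _ n n _ _ n] mult_add_distrib_mat[of _ n n _ n])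
        (auto intro!: eq_matI simp del: index_mult_mat(1))
    show ?thesis by (rule eq) (use carr in \<open>simp_all add: square_mat_simps\<close>)
  qed
  then show ?thesis
    unfolding tr TB TBw wTB ww Tt_def[symmetric]
    using carr
    by (auto intro!: eq_matI simp: algebra_simps simp del: index_mult_mat(1) index_mult_mat_vec)
qed

section \<open>From factorizations to similarity\<close>

text \<open>As \<open>E\<close> and \<open>- s L\<close> are mutually inverse, the factorization of
  \<open>Qi + P\<close> inverts to \<open>Xi = s E^T Pi E\<close>. Since
  \<open>1 + P Q = (Qi + P) Q\<close>, its inverse is \<open>Qi * Xi = 1 - P * Xi\<close>, and
  conjugation by \<open>Pi * E\<close> carries this to \<open>1 - s Pi E P E^T\<close>.\<close>

lemma similar_of_factorizations:
  fixes P Pi Q Qi R E L :: "'a :: field mat"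
  assumes P: "P \<in> carrier_mat n n" "Pi \<in> carrier_mat n n" "P * Pi = 1\<^sub>m n" "Pi * P = 1\<^sub>m n"
    and Q: "Q \<in> carrier_mat n n" "Qi \<in> carrier_mat n n" "Q * Qi = 1\<^sub>m n" "Qi * Q = 1\<^sub>m n"
    and R: "R \<in> carrier_mat n n" and E: "E \<in> carrier_mat n n" and L: "L \<in> carrier_mat n n"
    and s: "s \<noteq> 0"
    and X: "Qi + P = s \<cdot>\<^sub>m (L * P * transpose_mat L)"
    and Y: "P - R * Qi * transpose_mat R = s \<cdot>\<^sub>m (E * P * transpose_mat E)"
    and EL: "E * ((- s) \<cdot>\<^sub>m L) = 1\<^sub>m n"
  obtains S where "S \<in> carrier_mat n n" "(1\<^sub>m n + P * Q) * S = 1\<^sub>m n"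
    "similar_mat (Pi * R * Qi * transpose_mat R) S"
proof -
  define Ei where "Ei = (- s) \<cdot>\<^sub>m L"
  define Et where "Et = transpose_mat E"
  define Eit where "Eit = transpose_mat Ei"
  define Rt where "Rt = transpose_mat R"
  have Ei: "Ei \<in> carrier_mat n n" and Et: "Et \<in> carrier_mat n n" and Eit: "Eit \<in> carrier_mat n n"
    and Rt: "Rt \<in> carrier_mat n n"
    using E L R by (simp_all add: Ei_def Et_def Eit_def Rt_def)
  note carr = P(1,2) Q(1,2) R E L Ei Et Eit Rt
  have EEi: "E * Ei = 1\<^sub>m n" using EL by (simp add: Ei_def)
  have EiE: "Ei * E = 1\<^sub>m n" by (rule mat_mult_left_right_inverse[OF E Ei EEi])
  have EitEt: "Eit * Et = 1\<^sub>m n"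
    using arg_cong[OF EEi, of transpose_mat] transpose_mult[OF E Ei] by (simp add: Eit_def Et_def)
  have cancel: "M * (N * Z) = Z" if "M * N = 1\<^sub>m n" "M \<in> carrier_mat n n" "N \<in> carrier_mat n n"
    "Z \<in> carrier_mat n n" for M N Z :: "'a mat"
    using that by (simp add: assoc_mult_mat[of _ n n _ n _ n, symmetric])
  define Xi where "Xi = s \<cdot>\<^sub>m (Et * (Pi * E))"
  have Xi: "Xi \<in> carrier_mat n n" using carr by (simp add: Xi_def square_mat_simps)
  have XE: "Qi + P = (1 / s) \<cdot>\<^sub>m (Ei * (P * Eit))"
    unfolding X Ei_def Eit_def using L P(1) s
    by (simp add: square_mat_simps) (auto intro!: eq_matI simp del: index_mult_mat(1))
  have XXi: "(Qi + P) * Xi = 1\<^sub>m n"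
  proof -
    have "(Qi + P) * Xi = ((1 / s) * s) \<cdot>\<^sub>m (Ei * (P * (Eit * (Et * (Pi * E)))))"
      unfolding XE Xi_def using carr by (simp add: square_mat_simps)
        (auto intro!: eq_matI simp del: index_mult_mat(1))
    also have "\<dots> = 1\<^sub>m n"
      using carr s by (simp add: cancel[OF EitEt] cancel[OF P(3)] EiE square_mat_simps)
        (auto intro!: eq_matI)
    finally show ?thesis .
  qed
  define S where "S = 1\<^sub>m n - s \<cdot>\<^sub>m (P * (Et * (Pi * E)))"
  have S: "S \<in> carrier_mat n n" using carr by (simp add: S_def square_mat_simps)
  have QiXi: "Qi * Xi = S"
  proof -
    have "Qi * Xi = 1\<^sub>m n - P * Xi"
      by (rule mat_add_eqD[of _ n n]) (use carr Xi XXi in \<open>simp_all add: square_mat_simps\<close>)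
    then show ?thesis
      using carr unfolding S_def Xi_def by (simp add: square_mat_simps)
  qed
  have inv: "(1\<^sub>m n + P * Q) * S = 1\<^sub>m n"
  proof -
    have "1\<^sub>m n + P * Q = (Qi + P) * Q" using carr Q by (simp add: square_mat_simps)
    then have "(1\<^sub>m n + P * Q) * S = (Qi + P) * (Q * (Qi * Xi))"
      unfolding QiXi[symmetric] using carr Xi by (simp add: assoc_mult_mat[of _ n n _ n _ n] square_mat_simps)
    then show ?thesis using XXi Xi by (simp add: cancel[OF Q(3) Q(1,2)])
  qed
  have W: "Pi * R * Qi * Rt = 1\<^sub>m n - s \<cdot>\<^sub>m (Pi * (E * (P * Et)))"
  proof -
    have "R * (Qi * Rt) = P - s \<cdot>\<^sub>m (E * (P * Et))"
      by (rule mat_diff_eqD[of P n n]) (use Y carr in \<open>simp_all add: Rt_def Et_def square_mat_simps\<close>)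
    then have "Pi * (R * (Qi * Rt)) = 1\<^sub>m n - s \<cdot>\<^sub>m (Pi * (E * (P * Et)))"
      using carr P by (simp add: square_mat_simps)
    then show ?thesis using carr by (simp add: square_mat_simps)
  qed
  have "similar_mat_wit (Pi * R * Qi * Rt) S (Pi * E) (Ei * P)"
  proof (rule similar_mat_witI[of _ _ n])
    show "Pi * E * (Ei * P) = 1\<^sub>m n" "Ei * P * (Pi * E) = 1\<^sub>m n"
      using carr P EiE by (simp_all add: square_mat_simps cancel[OF EEi] cancel[OF P(3)])
    have "Pi * E * S * (Ei * P) = Pi * (E * (Ei * P)) - s \<cdot>\<^sub>m (Pi * (E * (P * (Et * (Pi * (E * (Ei * P)))))))"
      unfolding S_def using carr by (simp add: square_mat_simps)
    also have "\<dots> = 1\<^sub>m n - s \<cdot>\<^sub>m (Pi * (E * (P * Et)))"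
      using carr P by (simp add: cancel[OF EEi])
    finally show "Pi * R * Qi * Rt = Pi * E * S * (Ei * P)" unfolding W by simp
  qed (use carr S in \<open>simp_all add: square_mat_simps\<close>)
  then show thesis
    using that[OF S inv] unfolding similar_mat_def Rt_def by blast
qed

section \<open>Operators commuting with A\<close>

text \<open>Row \<open>a\<close> of the matrices \<open>F i\<close> assembles to a matrix \<open>F\<^sub>a\<close> with entries \<open>F i $$ (a, j)\<close>, which satisfies
  \<open>F\<^sub>a - B\<^sup>T F\<^sub>a B = w e\<^sub>a\<^sup>T - \<rho> w\<^sup>T\<close>, where \<open>\<rho>\<close> is row \<open>a\<close> of \<open>R B\<close>. Multiplying by \<open>Q\<^sup>-\<^sup>1\<close> and
  taking traces leaves only the defect of \<open>Q\<^sup>-\<^sup>1\<close>, i.e. the quadratic form of \<open>F\<^sub>a\<close> at \<open>m\<close>.\<close>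

lemma intertwiner_contraction:
  fixes A B R Qi :: "'a :: field mat" and F :: "nat \<Rightarrow> 'a mat"
  assumes A: "A \<in> carrier_mat n n" and R: "R \<in> carrier_mat n n" and Qi: "Qi \<in> carrier_mat n n"
    and v: "v \<in> carrier_vec n" and w: "w \<in> carrier_vec n" and m: "m \<in> carrier_vec n"
    and B: "B = A + outer_prod v w"
    and stein: "R - A * R * B = outer_prod v w"
    and sym: "transpose_mat Qi = Qi"
    and BQiB: "B * Qi * transpose_mat B = Qi - s \<cdot>\<^sub>m outer_prod m m"
    and F: "\<And>i. i < n \<Longrightarrow> F i \<in> carrier_mat n n" "\<And>i. i < n \<Longrightarrow> A * F i = F i * A"
      "\<And>i. i < n \<Longrightarrow> F i *\<^sub>v v = col R i"
    and uniq: "\<And>M. M \<in> carrier_mat n n \<Longrightarrow> A * M = M * A \<Longrightarrow> M *\<^sub>v v = 0\<^sub>v n \<Longrightarrow> M = 0\<^sub>m n n"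
  defines "G \<equiv> mat n n (\<lambda>(r, c). \<Sum>i\<in>{0..<n}. m $ i * F i $$ (r, c))"
  shows "s \<cdot>\<^sub>v (G *\<^sub>v m) = Qi *\<^sub>v w - R *\<^sub>v (B *\<^sub>v (Qi *\<^sub>v w))"
proof (rule eq_vecI)
  define g where "g = Qi *\<^sub>v w"
  have g: "g \<in> carrier_vec n" using Qi w by (simp add: g_def)
  have Bc: "B \<in> carrier_mat n n" using A v w by (simp add: B)
  have G: "G \<in> carrier_mat n n" by (simp add: G_def)
  note carr = A R Qi v w m g Bc
  \<comment> \<open>The matrix \<open>F i - A * S - w $ i\<close> commutes with \<open>A\<close>
    and, by the Stein equation for \<open>R\<close>, kills \<open>v\<close>; hence it is zero. Then
    \<open>A * S = S * A\<close> is rewritten as \<open>S * B\<close> minus the rank-one matrix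
    formed from \<open>S *\<^sub>v v\<close> and \<open>w\<close>.\<close>
  have F_eq: "F i $$ (a, j) = (\<Sum>l\<in>{0..<n}. (\<Sum>k\<in>{0..<n}. B $$ (k, i) * F k $$ (a, l)) * B $$ (l, j))
      - (R * B) $$ (a, i) * w $ j + (if a = j then w $ i else 0)"
    if ij: "i < n" "a < n" "j < n" for i a j
  proof -
    define S where "S = mat n n (\<lambda>(r, c). \<Sum>k\<in>{0..<n}. col B i $ k * F k $$ (r, c))"
    have S: "S \<in> carrier_mat n n" by (simp add: S_def)
    have colB: "col B i \<in> carrier_vec n" using Bc ij by auto
    have AS: "A * S = S * A" and Sv: "S *\<^sub>v v = R *\<^sub>v col B i"
      unfolding S_def by (rule commuting_linear_combination[OF A v R colB F]; assumption)+
    have Fi: "F i \<in> carrier_mat n n" using F ij by simp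
    have AFi: "A * F i = F i * A" using F ij by simp
    have "R *\<^sub>v col B i = col (R * B) i"
      using col_mult2[OF R Bc ij(1)] by simp
    moreover have "A *\<^sub>v col (R * B) i = col (A * (R * B)) i"
      using col_mult2[OF A mult_carrier_mat[OF R Bc] ij(1)] by simp
    moreover have "A * (R * B) = R - outer_prod v w"
      by (rule mat_diff_eqD[of R n n, rotated 2]) (use carr stein in \<open>simp_all add: square_mat_simps\<close>)
    ultimately have ARB: "A *\<^sub>v (R *\<^sub>v col B i) = col (R - outer_prod v w) i"
      by simp
    define M where "M = F i - A * S - w $ i \<cdot>\<^sub>m 1\<^sub>m n"
    have M: "M \<in> carrier_mat n n" using Fi A S by (simp add: M_def)
    have "A * (S * A) = S * (A * A)"
      using arg_cong[OF AS, of "\<lambda>X. X * A"] A S by (simp add: square_mat_simps)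
    then have "A * M = M * A"
      unfolding M_def using A S Fi by (simp add: square_mat_simps AFi AS)
    moreover have "M *\<^sub>v v = 0\<^sub>v n"
    proof -
      have "M *\<^sub>v v = col R i - col (R - outer_prod v w) i - w $ i \<cdot>\<^sub>v v"
        unfolding M_def using A S Fi v F(3)[OF ij(1)] by (simp add: square_mat_simps Sv ARB)
      also have "\<dots> = 0\<^sub>v n"
        by (rule eq_vecI) (use R v w ij in \<open>auto\<close>)
      finally show ?thesis .
    qed
    ultimately have M0: "M = 0\<^sub>m n n" by (rule uniq[OF M])
    have SB: "S * B = A * S + outer_prod (R *\<^sub>v col B i) w"
      unfolding B AS using A S v w by (simp add: square_mat_simps Sv[unfolded B])
    have "M $$ (a, j) = 0" using M0 ij by simp
    then have "F i $$ (a, j) = (A * S) $$ (a, j) + (if a = j then w $ i else 0)"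
      unfolding M_def using Fi A S ij by (auto simp: algebra_simps simp del: index_mult_mat(1) split: if_splits)
    moreover have "(S * B) $$ (a, j) = (A * S) $$ (a, j) + (R * B) $$ (a, i) * w $ j"
      unfolding SB using A S R Bc w ij by simp
    moreover have "(S * B) $$ (a, j)
        = (\<Sum>l\<in>{0..<n}. (\<Sum>k\<in>{0..<n}. B $$ (k, i) * F k $$ (a, l)) * B $$ (l, j))"
      using index_mult_mat_sum[OF S Bc ij(2,3)] Bc ij by (simp add: S_def)
    ultimately show ?thesis by simp
  qed
  fix a assume "a < dim_vec (Qi *\<^sub>v w - R *\<^sub>v (B *\<^sub>v (Qi *\<^sub>v w)))"
  then have a: "a < n" using R by simp
  define Fa where "Fa = mat n n (\<lambda>(i, j). F i $$ (a, j))"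
  define Bt where "Bt = transpose_mat B"
  define \<rho> where "\<rho> = row (R * B) a"
  define e :: "'a vec" where "e = unit_vec n a"
  have Fa: "Fa \<in> carrier_mat n n" and Bt: "Bt \<in> carrier_mat n n" and \<rho>: "\<rho> \<in> carrier_vec n"
    and e: "e \<in> carrier_vec n"
    using Bc by (auto simp: Fa_def Bt_def \<rho>_def e_def intro: carrier_vecI)
  have Fa_eq: "Fa = Bt * (Fa * B) - outer_prod \<rho> w + outer_prod w e"
  proof (rule eq_matI)
    fix i j assume "i < dim_row (Bt * (Fa * B) - outer_prod \<rho> w + outer_prod w e)"
      "j < dim_col (Bt * (Fa * B) - outer_prod \<rho> w + outer_prod w e)"
    then have ij: "i < n" "j < n" using w e by auto
    have "(Bt * (Fa * B)) $$ (i, j) = (\<Sum>k\<in>{0..<n}. B $$ (k, i) * (\<Sum>l\<in>{0..<n}. F k $$ (a, l) * B $$ (l, j)))"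
    proof -
      have "(Bt * (Fa * B)) $$ (i, j) = (\<Sum>k\<in>{0..<n}. Bt $$ (i, k) * (Fa * B) $$ (k, j))"
        by (rule index_mult_mat_sum[OF Bt mult_carrier_mat[OF Fa Bc] ij])
      also have "\<dots> = (\<Sum>k\<in>{0..<n}. B $$ (k, i) * (\<Sum>l\<in>{0..<n}. F k $$ (a, l) * B $$ (l, j)))"
        using index_mult_mat_sum[OF Fa Bc _ ij(2)] Bc ij
        by (intro sum.cong) (simp_all add: Bt_def Fa_def)
      finally show ?thesis .
    qed
    also have "\<dots> = (\<Sum>l\<in>{0..<n}. (\<Sum>k\<in>{0..<n}. B $$ (k, i) * F k $$ (a, l)) * B $$ (l, j))"
      unfolding sum_distrib_left sum_distrib_right mult.assoc by (rule sum.swap)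
    finally have "(Bt * (Fa * B)) $$ (i, j) = \<dots>" .
    moreover have "\<rho> $ i = (R * B) $$ (a, i)"
      using R Bc a ij by (simp add: \<rho>_def)
    ultimately show "Fa $$ (i, j) = (Bt * (Fa * B) - outer_prod \<rho> w + outer_prod w e) $$ (i, j)"
      using F_eq[OF ij(1) a ij(2)] ij a w \<rho> e Bt Fa Bc R
      by (simp add: Fa_def e_def del: index_mult_mat(1))
  qed (use w e Fa in auto)
  have "Fa * Qi = Bt * (Fa * (B * Qi)) - outer_prod \<rho> g + outer_prod w (Qi *\<^sub>v e)"
  proof -
    have "Fa * Qi = (Bt * (Fa * B) - outer_prod \<rho> w + outer_prod w e) * Qi" using Fa_eq by simp
    also have "\<dots> = Bt * (Fa * (B * Qi)) - outer_prod \<rho> g + outer_prod w (Qi *\<^sub>v e)"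
      using carr Fa Bt \<rho> e by (simp add: square_mat_simps sym g_def)
    finally show ?thesis .
  qed
  then have "mtrace (Fa * Qi) = mtrace (Bt * (Fa * (B * Qi))) - \<rho> \<bullet> g + w \<bullet> (Qi *\<^sub>v e)"
    using carr Fa Bt \<rho> e
    by (simp add: mtrace_add[of _ n] mtrace_minus[of _ n] mtrace_outer_prod[of _ n] square_mat_simps)
  \<comment> \<open>Cyclicity of the trace brings \<open>B * Qi * Bt\<close> together. The term
    \<open>mtrace (Fa * Qi)\<close> then occurs on both sides of the previous equation and
    cancels.\<close>
  moreover have "mtrace (Bt * (Fa * (B * Qi))) = mtrace (Fa * Qi) - s * ((Fa *\<^sub>v m) \<bullet> m)"
  proof -
    have "mtrace (Bt * (Fa * (B * Qi))) = mtrace (Fa * (B * Qi) * Bt)"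
      by (rule mtrace_mult_comm[of _ n n]) (use carr Fa Bt in \<open>simp_all add: square_mat_simps\<close>)
    also have "Fa * (B * Qi) * Bt = Fa * (B * Qi * Bt)"
      using carr Fa Bt by (simp add: square_mat_simps)
    also have "mtrace \<dots> = mtrace (Fa * Qi) - s * ((Fa *\<^sub>v m) \<bullet> m)"
      unfolding Bt_def BQiB using carr Fa
      by (simp add: mtrace_minus[of _ n] mtrace_smult[of _ n] mtrace_outer_prod[of _ n] square_mat_simps)
    finally show ?thesis .
  qed
  moreover have "(Fa *\<^sub>v m) \<bullet> m = (G *\<^sub>v m) $ a"
  proof -
    have "(Fa *\<^sub>v m) \<bullet> m = (\<Sum>i\<in>{0..<n}. \<Sum>j\<in>{0..<n}. m $ i * F i $$ (a, j) * m $ j)"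
      using m by (simp add: Fa_def scalar_prod_def sum_distrib_left sum_distrib_right mult_ac)
    also have "\<dots> = (\<Sum>j\<in>{0..<n}. \<Sum>i\<in>{0..<n}. m $ i * F i $$ (a, j) * m $ j)"
      by (rule sum.swap)
    also have "\<dots> = (G *\<^sub>v m) $ a"
      using m a by (simp add: G_def scalar_prod_def sum_distrib_left sum_distrib_right mult_ac)
    finally show ?thesis .
  qed
  moreover have "w \<bullet> (Qi *\<^sub>v e) = g $ a"
    using transpose_vec_mult_scalar[OF Qi e w] g a by (simp add: sym g_def[symmetric] e_def)
  moreover have "\<rho> \<bullet> g = (R *\<^sub>v (B *\<^sub>v g)) $ a"
  proof -
    have "\<rho> \<bullet> g = ((R * B) *\<^sub>v g) $ a" using R a by (simp add: \<rho>_def)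
    then show ?thesis using carr by (simp add: square_mat_simps)
  qed
  ultimately show "(s \<cdot>\<^sub>v (G *\<^sub>v m)) $ a = (Qi *\<^sub>v w - R *\<^sub>v (B *\<^sub>v (Qi *\<^sub>v w))) $ a"
    using a G R g by (simp add: g_def[symmetric] del: index_mult_mat_vec)
qed (use R in \<open>simp add: G_def\<close>)

section \<open>Stein equations over the reals\<close>

text \<open>The entrywise embedding into the complex numbers respects products and is injective, so
  the complex uniqueness result transfers.\<close>

lemma real_stein_unique:
  fixes A C Z :: "real mat"
  assumes A: "A \<in> carrier_mat n n" and C: "C \<in> carrier_mat n n" and Z: "Z \<in> carrier_mat n n"
    and nonres: "\<And>\<alpha> \<gamma>. \<alpha> \<in> cspectrum A \<Longrightarrow> \<gamma> \<in> cspectrum C \<Longrightarrow> \<alpha> * \<gamma> \<noteq> 1"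
    and eq: "Z = A * Z * C"
  shows "Z = 0\<^sub>m n n"
proof -
  let ?c = "map_mat complex_of_real"
  have "?c Z = ?c A * ?c Z * ?c C"
    using of_real_hom.mat_hom_mult[OF A Z] of_real_hom.mat_hom_mult[OF mult_carrier_mat[OF A Z] C] eq
    by metis
  then have "?c Z = 0\<^sub>m n n"
    using nonres A C Z by (intro complex_stein_unique[of "?c A" n "?c C" n]) (auto simp: cspectrum_def)
  then have "complex_of_real (Z $$ (i, j)) = 0" if "i < n" "j < n" for i j
    using Z that by (metis index_map_mat(1) index_zero_mat(1) carrier_matD)
  then show ?thesis using Z by (intro eq_matI) auto
qed

text \<open>Identifies a matrix by the right-hand side of its Stein equation: the difference of two
  solutions solves the homogeneous equation.\<close>

lemma real_stein_eqI:
  fixes A C X Y :: "real mat"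
  assumes A: "A \<in> carrier_mat n n" and C: "C \<in> carrier_mat n n"
    and X: "X \<in> carrier_mat n n" and Y: "Y \<in> carrier_mat n n"
    and nonres: "\<And>\<alpha> \<gamma>. \<alpha> \<in> cspectrum A \<Longrightarrow> \<gamma> \<in> cspectrum C \<Longrightarrow> \<alpha> * \<gamma> \<noteq> 1"
    and eq: "X - A * X * C = Y - A * Y * C"
  shows "X = Y"
proof -
  have "(X - Y) $$ (i, j) = (A * X * C - A * Y * C) $$ (i, j)" if "i < n" "j < n" for i j
    using arg_cong[OF eq, of "\<lambda>Z. Z $$ (i, j)"] A C X Y that
    by (simp del: index_mult_mat(1))
  then have "X - Y = A * X * C - A * Y * C"
    using A C X Y by (intro eq_matI) auto
  also have "\<dots> = A * (X - Y) * C"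
    using A C X Y by (simp add: square_mat_simps)
  finally have "X - Y = A * (X - Y) * C" .
  then have "X - Y = 0\<^sub>m n n"
    by (rule real_stein_unique[OF A C _ nonres, rotated -1]) (use X Y in auto)
  then have "Y = X - 0\<^sub>m n n"
    by (intro mat_diff_eqD[OF X Y]) simp
  then show ?thesis using X by auto
qed

lemma cspectrum_transpose:
  assumes "X \<in> carrier_mat n n"
  shows "cspectrum (transpose_mat X) = cspectrum X"
proof -
  let ?X = "map_mat complex_of_real X"
  have X: "?X \<in> carrier_mat n n" using assms by simp
  then have Xt: "transpose_mat ?X \<in> carrier_mat n n" by simp
  have "cspectrum (transpose_mat X) = spectrum (transpose_mat ?X)"
    by (simp add: cspectrum_def map_mat_transpose)
  then show ?thesis
    unfolding cspectrum_def spectrum_root_char_poly[OF X] spectrum_root_char_poly[OF Xt]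
    using X by simp
qed

text \<open>A complex solution exists, and its entrywise real part is again a solution because
  \<open>A\<close>, \<open>v\<close> and \<open>u\<close> are real and both conditions on
  \<open>M\<close> are linear.\<close>

lemma real_commuting_exists:
  fixes A P :: "real mat"
  assumes A: "A \<in> carrier_mat n n" and P: "P \<in> carrier_mat n n"
    and v: "v \<in> carrier_vec n" and u: "u \<in> carrier_vec n"
    and nonres: "\<And>\<alpha> \<gamma>. \<alpha> \<in> cspectrum A \<Longrightarrow> \<gamma> \<in> cspectrum A \<Longrightarrow> \<alpha> * \<gamma> \<noteq> 1"
    and stein: "P - A * P * transpose_mat A = outer_prod v v"
    and det_P: "det P \<noteq> 0"
  obtains M where "M \<in> carrier_mat n n" "A * M = M * A" "M *\<^sub>v v = u"
proof -
  let ?c = "map_mat complex_of_real"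
  let ?cv = "map_vec complex_of_real"
  have "?c (A * P * transpose_mat A) = ?c A * ?c P * transpose_mat (?c A)"
    using of_real_hom.mat_hom_mult[OF A P] A
      of_real_hom.mat_hom_mult[OF mult_carrier_mat[OF A P], of "transpose_mat A" n]
    unfolding map_mat_transpose by (metis transpose_carrier_mat)
  moreover have "?c (P - A * P * transpose_mat A) = ?c P - ?c (A * P * transpose_mat A)"
    using A P by (auto intro!: eq_matI simp del: index_mult_mat(1))
  moreover have "?c (outer_prod v v) = outer_prod (?cv v) (?cv v)"
    by (auto intro!: eq_matI)
  ultimately have "?c P - ?c A * ?c P * transpose_mat (?c A) = outer_prod (?cv v) (?cv v)"
    using stein by metis
  moreover have "det (?c P) \<noteq> 0"
    using det_P by simp
  ultimately obtain M where M: "M \<in> carrier_mat n n" "?c A * M = M * ?c A" "M *\<^sub>v ?cv v = ?cv u"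
    using complex_commuting_exists[of "?c A" n "?c P" "?cv v" "?cv u"] A P v u nonres
    by (auto simp: cspectrum_def)
  define N where "N = map_mat Re M"
  have N: "N \<in> carrier_mat n n" using M by (simp add: N_def)
  have "A * N = N * A"
  proof (rule eq_matI)
    fix i j assume "i < dim_row (N * A)" "j < dim_col (N * A)"
    then have ij: "i < n" "j < n" using A N by auto
    have "Re ((?c A * M) $$ (i, j)) = (A * N) $$ (i, j)"
      using A M(1) ij by (simp add: N_def scalar_prod_def)
    moreover have "Re ((M * ?c A) $$ (i, j)) = (N * A) $$ (i, j)"
      using A M(1) ij by (simp add: N_def scalar_prod_def)
    ultimately show "(A * N) $$ (i, j) = (N * A) $$ (i, j)" using M(2) by simp
  qed (use A N in auto)
  moreover have "N *\<^sub>v v = u"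
  proof (rule eq_vecI)
    fix i assume "i < dim_vec u"
    then have i: "i < n" using u by simp
    have "Re ((M *\<^sub>v ?cv v) $ i) = (N *\<^sub>v v) $ i"
      using v M(1) i by (simp add: N_def scalar_prod_def)
    then show "(N *\<^sub>v v) $ i = u $ i" using M(3) i u by simp
  qed (use u N in auto)
  ultimately show thesis using N by (intro that)
qed

section \<open>Stein equations under commuting matrices, sums and differences\<close>

text \<open>Because \<open>M\<close> and \<open>N\<close> commute with \<open>A\<close>, they can be
  pulled out of the Stein operator, which leaves \<open>M (v v^T) N^T\<close>. The case
  \<open>N = 1\<close> serves uniqueness, the case \<open>N = M\<close> the factorizations.\<close>

lemma stein_commuting:
  fixes A P M :: "'a :: comm_ring_1 mat"
  assumes A: "A \<in> carrier_mat n n" and P: "P \<in> carrier_mat n n" and M: "M \<in> carrier_mat n n"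
    and N: "N \<in> carrier_mat n n"
    and v: "v \<in> carrier_vec n"
    and AM: "A * M = M * A" and AN: "A * N = N * A"
    and stein: "P - A * P * transpose_mat A = outer_prod v v"
  shows "M * P * transpose_mat N - A * (M * P * transpose_mat N) * transpose_mat A
    = outer_prod (M *\<^sub>v v) (N *\<^sub>v v)"
proof -
  define At where "At = transpose_mat A"
  define Nt where "Nt = transpose_mat N"
  have At: "At \<in> carrier_mat n n" and Nt: "Nt \<in> carrier_mat n n" using A N by (simp_all add: At_def Nt_def)
  have AtNt: "Nt * At = At * Nt"
    using arg_cong[OF AN, of transpose_mat] A N by (simp add: At_def Nt_def square_mat_simps)
  have "A * (M * P * Nt) * At = (A * M) * (P * (Nt * At))"
    using A M P At Nt by (simp add: square_mat_simps)
  also have "\<dots> = M * ((A * P * At) * Nt)"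
    unfolding AM AtNt using A M P At Nt by (simp add: square_mat_simps)
  also have "M * P * Nt - \<dots> = M * ((P - A * P * At) * Nt)"
    using A M P At Nt by (simp add: square_mat_simps)
  also have "\<dots> = outer_prod (M *\<^sub>v v) (N *\<^sub>v v)"
    unfolding At_def stein Nt_def using M N v by (simp add: square_mat_simps)
  finally show ?thesis by (simp add: At_def Nt_def)
qed

lemma stein_commuting_smult:
  fixes A P M :: "'a :: comm_ring_1 mat" and s :: 'a
  assumes A: "A \<in> carrier_mat n n" and P: "P \<in> carrier_mat n n" and M: "M \<in> carrier_mat n n"
    and v: "v \<in> carrier_vec n" and AM: "A * M = M * A"
    and stein: "P - A * P * transpose_mat A = outer_prod v v"
  defines "X \<equiv> s \<cdot>\<^sub>m (M * P * transpose_mat M)"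
  shows "X - A * X * transpose_mat A = s \<cdot>\<^sub>m outer_prod (M *\<^sub>v v) (M *\<^sub>v v)"
proof -
  define Z where "Z = M * P * transpose_mat M"
  have Z: "Z \<in> carrier_mat n n" using M P by (simp add: Z_def square_mat_simps)
  have "X - A * X * transpose_mat A = s \<cdot>\<^sub>m (Z - A * Z * transpose_mat A)"
    unfolding X_def Z_def[symmetric] using A Z
    by (simp add: square_mat_simps) (auto intro!: eq_matI simp: algebra_simps simp del: index_mult_mat(1))
  then show ?thesis
    unfolding Z_def stein_commuting[OF A P M M v AM AM stein] .
qed

text \<open>Meant for \<open>X = Qi\<close>: the terms \<open>outer_prod v v\<close> from
  \<open>X\<close> and from \<open>P\<close> cancel in the sum.\<close>

lemma stein_add:
  fixes A P X :: "'a :: comm_ring_1 mat"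
  assumes A: "A \<in> carrier_mat n n" and P: "P \<in> carrier_mat n n" and X: "X \<in> carrier_mat n n"
    and v: "v \<in> carrier_vec n" and Z: "Z \<in> carrier_mat n n"
    and stein: "P - A * P * transpose_mat A = outer_prod v v"
    and AXA: "A * X * transpose_mat A = X + outer_prod v v - Z"
  shows "(X + P) - A * (X + P) * transpose_mat A = Z"
proof -
  define At where "At = transpose_mat A"
  have At: "At \<in> carrier_mat n n" using A by (simp add: At_def)
  have "A * P * At = P - outer_prod v v"
    unfolding At_def by (rule mat_diff_eqD[of P n n, OF _ _ stein[symmetric]])
      (use A P in \<open>simp_all add: square_mat_simps\<close>)
  moreover have "A * (X + P) * At = A * X * At + A * P * At"
    using A P X At by (simp add: square_mat_simps)
  ultimately have "A * (X + P) * At = (X + outer_prod v v - Z) + (P - outer_prod v v)"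
    using AXA by (simp add: At_def)
  then show ?thesis
    unfolding At_def[symmetric] using P X Z v by (auto intro!: eq_matI)
qed

text \<open>Meant for \<open>X = R Qi R^T\<close>, where \<open>outer_prod v v\<close> enters with
  the opposite sign, so that the difference with \<open>P\<close> cancels it.\<close>

lemma stein_diff:
  fixes A P X Z :: "'a :: comm_ring_1 mat"
  assumes A: "A \<in> carrier_mat n n" and P: "P \<in> carrier_mat n n" and X: "X \<in> carrier_mat n n"
    and v: "v \<in> carrier_vec n" and Z: "Z \<in> carrier_mat n n"
    and stein: "P - A * P * transpose_mat A = outer_prod v v"
    and X_eq: "X = A * X * transpose_mat A + outer_prod v v - Z"
  shows "(P - X) - A * (P - X) * transpose_mat A = Z"
proof -
  define At where "At = transpose_mat A"
  define Y where "Y = A * X * At"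
  have At: "At \<in> carrier_mat n n" using A by (simp add: At_def)
  have Y: "Y \<in> carrier_mat n n" using A X At by (simp add: Y_def square_mat_simps)
  have "A * P * At = P - outer_prod v v"
    unfolding At_def by (rule mat_diff_eqD[of P n n, OF _ _ stein[symmetric]])
      (use A P in \<open>simp_all add: square_mat_simps\<close>)
  moreover have "A * (P - X) * At = A * P * At - Y"
    using A P X At by (simp add: Y_def square_mat_simps)
  ultimately have "A * (P - X) * At = P - outer_prod v v - Y" by simp
  moreover have "X = Y + outer_prod v v - Z" using X_eq by (simp add: Y_def At_def)
  ultimately show ?thesis
    unfolding At_def[symmetric] using P Y Z v by (auto intro!: eq_matI)
qed

text \<open>The product \<open>M * P\<close> solves a Stein equation with right-hand side
  \<open>(M v) v^T = 0\<close>, hence vanishes, and \<open>P\<close> can be cancelled.\<close>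

lemma real_commuting_unique:
  fixes A P M :: "real mat"
  assumes A: "A \<in> carrier_mat n n" and P: "P \<in> carrier_mat n n" and M: "M \<in> carrier_mat n n"
    and v: "v \<in> carrier_vec n"
    and nonres: "\<And>\<alpha> \<gamma>. \<alpha> \<in> cspectrum A \<Longrightarrow> \<gamma> \<in> cspectrum A \<Longrightarrow> \<alpha> * \<gamma> \<noteq> 1"
    and stein: "P - A * P * transpose_mat A = outer_prod v v"
    and det_P: "det P \<noteq> 0"
    and AM: "A * M = M * A" and Mv: "M *\<^sub>v v = 0\<^sub>v n"
  shows "M = 0\<^sub>m n n"
proof -
  obtain Pi where Pi: "Pi \<in> carrier_mat n n" "P * Pi = 1\<^sub>m n"
    using mat_inverse_exists[OF P det_P] by blast
  have "M * P - A * (M * P) * transpose_mat A = outer_prod (0\<^sub>v n) v"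
    using stein_commuting[OF A P M one_carrier_mat v AM _ stein] A M P v Mv by simp
  also have "\<dots> = 0\<^sub>m n n - A * 0\<^sub>m n n * transpose_mat A"
    using A v by (auto intro!: eq_matI)
  finally have eq: "M * P - A * (M * P) * transpose_mat A = 0\<^sub>m n n - A * 0\<^sub>m n n * transpose_mat A" .
  have "M * P = 0\<^sub>m n n"
    by (rule real_stein_eqI[OF A _ _ _ _ eq])
      (use A P M nonres cspectrum_transpose[OF A] in \<open>auto simp: square_mat_simps\<close>)
  then have "M * P * Pi = 0\<^sub>m n n" using Pi by simp
  then show ?thesis using M P Pi by (simp add: square_mat_simps)
qed

section \<open>The transfer operator\<close>

text \<open>The last claim is the inner property of the transfer function read off at
  \<open>v\<close>. Expanding \<open>s E m\<close> with the formula for \<open>G m\<close>, the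
  relation \<open>B g = A g + (w \<bullet> g) v\<close> and the Stein equation at \<open>g\<close>
  gives \<open>- R g\<close>. Subtracting \<open>s d E v\<close> then leaves
  \<open>- v\<close>.\<close>

lemma transfer_operator:
  fixes A B R G :: "'a :: field mat" and s d :: 'a
  assumes A: "A \<in> carrier_mat n n" and R: "R \<in> carrier_mat n n" and G: "G \<in> carrier_mat n n"
    and v: "v \<in> carrier_vec n" and w: "w \<in> carrier_vec n" and m: "m \<in> carrier_vec n"
    and g: "g \<in> carrier_vec n"
    and B: "B = A + outer_prod v w" and stein: "R - A * R * B = outer_prod v w"
    and AG: "A * G = G * A" and Gv: "G *\<^sub>v v = R *\<^sub>v m"
    and Gm: "s \<cdot>\<^sub>v (G *\<^sub>v m) = g - R *\<^sub>v (B *\<^sub>v g)"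
    and Bg: "B *\<^sub>v g = (- s * d) \<cdot>\<^sub>v m" and wg: "w \<bullet> g = 1 - s * d * d"
  defines "E \<equiv> d \<cdot>\<^sub>m 1\<^sub>m n + A * G"
  shows "A * E = E * A" "E *\<^sub>v v = A * R *\<^sub>v m + d \<cdot>\<^sub>v v"
    "s \<cdot>\<^sub>v (E *\<^sub>v (m - d \<cdot>\<^sub>v v)) = - v"
proof -
  have Bc: "B \<in> carrier_mat n n" using A v w by (simp add: B)
  have E: "E \<in> carrier_mat n n" using A G by (simp add: E_def)
  note carr = A R G v w m g Bc
  have "A * (G * A) = G * (A * A)"
    using arg_cong[OF AG, of "\<lambda>X. X * A"] A G by (simp add: square_mat_simps)
  then show "A * E = E * A"
    unfolding E_def using A G by (simp add: square_mat_simps AG)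
  define p where "p = A *\<^sub>v (R *\<^sub>v m)"
  have p: "p \<in> carrier_vec n" using carr by (simp add: p_def square_mat_simps)
  have Ev: "E *\<^sub>v v = d \<cdot>\<^sub>v v + p"
    unfolding E_def p_def using carr by (simp add: square_mat_simps Gv)
  have ARm: "A * R *\<^sub>v m = p" using carr by (simp add: p_def square_mat_simps)
  show "E *\<^sub>v v = A * R *\<^sub>v m + d \<cdot>\<^sub>v v"
    unfolding Ev ARm using v p by (simp add: comm_add_vec[of _ n])
  have "A * R * B = R - outer_prod v w"
    by (rule mat_diff_eqD[of R n n, OF _ _ stein[symmetric]]) (use carr in \<open>simp_all add: square_mat_simps\<close>)
  then have "(A * R * B) *\<^sub>v g = R *\<^sub>v g - (w \<bullet> g) \<cdot>\<^sub>v v"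
    using carr by (simp add: square_mat_simps)
  moreover have "(A * R * B) *\<^sub>v g = A *\<^sub>v (R *\<^sub>v (B *\<^sub>v g))"
    using carr by (simp add: square_mat_simps)
  ultimately have ARBg: "A *\<^sub>v (R *\<^sub>v (B *\<^sub>v g)) = R *\<^sub>v g - (w \<bullet> g) \<cdot>\<^sub>v v" by simp
  have sp: "A *\<^sub>v (R *\<^sub>v (B *\<^sub>v g)) = (- s * d) \<cdot>\<^sub>v p"
    unfolding Bg p_def using carr by (simp add: square_mat_simps)
  have Ag: "B *\<^sub>v g = A *\<^sub>v g + (w \<bullet> g) \<cdot>\<^sub>v v"
    unfolding B using carr by (simp add: square_mat_simps)
  have "s \<cdot>\<^sub>v (E *\<^sub>v m) = s \<cdot>\<^sub>v (d \<cdot>\<^sub>v m + A *\<^sub>v (G *\<^sub>v m))"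
    unfolding E_def using carr by (simp add: square_mat_simps)
  also have "\<dots> = (s * d) \<cdot>\<^sub>v m + A *\<^sub>v (s \<cdot>\<^sub>v (G *\<^sub>v m))"
    using carr by (simp add: square_mat_simps smult_add_distrib_vec[of _ n] smult_smult_assoc)
  also have "A *\<^sub>v (s \<cdot>\<^sub>v (G *\<^sub>v m)) = A *\<^sub>v g - (R *\<^sub>v g - (w \<bullet> g) \<cdot>\<^sub>v v)"
    unfolding Gm ARBg[symmetric] using carr by (simp add: square_mat_simps)
  finally have Em: "s \<cdot>\<^sub>v (E *\<^sub>v m) = (s * d) \<cdot>\<^sub>v m + (A *\<^sub>v g - (R *\<^sub>v g - (w \<bullet> g) \<cdot>\<^sub>v v))" .
  have Ef: "E *\<^sub>v (m - d \<cdot>\<^sub>v v) = E *\<^sub>v m - d \<cdot>\<^sub>v (d \<cdot>\<^sub>v v + p)"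
    using carr E Ev by (simp add: square_mat_simps)
  \<comment> \<open>The vector computation in one coordinate: \<mu>, \<gamma>, \<rho>, \<nu>, \<pi>
    stand for the entries of \<open>m\<close>, \<open>A g\<close>, \<open>R g\<close>,
    \<open>v\<close>, \<open>p\<close>, and \<open>q\<close> for
    \<open>w \<bullet> g\<close>.\<close>
  have alg: "x = - \<nu>"
    if "a = s * d * \<mu> + (\<gamma> - (\<rho> - q * \<nu>))" "- s * d * \<mu> = \<gamma> + q * \<nu>" "\<rho> - q * \<nu> = - s * d * \<pi>"
      "x = a - s * (d * (d * \<nu> + \<pi>))" "q = 1 - s * d * d" for x a \<mu> \<gamma> \<rho> \<nu> \<pi> q :: 'a
  proof -
    have \<gamma>: "\<gamma> = - s * d * \<mu> - q * \<nu>" using that(2) by (simp add: algebra_simps)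
    have a: "a = s * d * \<mu> + (\<gamma> + s * d * \<pi>)" using that(1,3) by simp
    have "x = s * d * \<mu> + (- s * d * \<mu> - q * \<nu> + s * d * \<pi>) - s * (d * (d * \<nu> + \<pi>))"
      using that(4) unfolding a \<gamma> .
    then show ?thesis unfolding that(5) by (simp add: algebra_simps)
  qed
  show "s \<cdot>\<^sub>v (E *\<^sub>v (m - d \<cdot>\<^sub>v v)) = - v"
  proof (rule eq_vecI)
    fix i assume "i < dim_vec (- v)"
    then have i: "i < n" using v by simp
    have "s * (E *\<^sub>v m) $ i = s * d * m $ i + ((A *\<^sub>v g) $ i - ((R *\<^sub>v g) $ i - (w \<bullet> g) * v $ i))"
      using arg_cong[OF Em, of "\<lambda>x. x $ i"] carr E i by (simp del: index_mult_mat_vec)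
    moreover have "- s * d * m $ i = (A *\<^sub>v g) $ i + (w \<bullet> g) * v $ i"
      using arg_cong[OF Ag[unfolded Bg], of "\<lambda>x. x $ i"] carr i by (simp del: index_mult_mat_vec)
    moreover have "(R *\<^sub>v g) $ i - (w \<bullet> g) * v $ i = - s * d * p $ i"
      using arg_cong[OF sp[unfolded ARBg], of "\<lambda>x. x $ i"] carr p i by (simp del: index_mult_mat_vec)
    moreover have "(s \<cdot>\<^sub>v (E *\<^sub>v (m - d \<cdot>\<^sub>v v))) $ i = s * (E *\<^sub>v m) $ i - s * (d * (d * v $ i + p $ i))"
      unfolding Ef using carr E p i by (simp add: algebra_simps del: index_mult_mat_vec)
    ultimately have "(s \<cdot>\<^sub>v (E *\<^sub>v (m - d \<cdot>\<^sub>v v))) $ i = - v $ i"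
      using wg by (rule alg)
    then show "(s \<cdot>\<^sub>v (E *\<^sub>v (m - d \<cdot>\<^sub>v v))) $ i = (- v) $ i"
      using v i by simp
  qed (use v E in auto)
qed

text \<open>The matrix \<open>1 + s E L\<close> commutes with \<open>A\<close> and kills
  \<open>v\<close>, so uniqueness makes it zero.\<close>

lemma commuting_inverse:
  fixes A E L :: "'a :: comm_ring_1 mat"
  assumes A: "A \<in> carrier_mat n n" and E: "E \<in> carrier_mat n n" and L: "L \<in> carrier_mat n n"
    and v: "v \<in> carrier_vec n" and AE: "A * E = E * A" and AL: "A * L = L * A"
    and ELv: "s \<cdot>\<^sub>v (E *\<^sub>v (L *\<^sub>v v)) = - v"
    and uniq: "\<And>M. M \<in> carrier_mat n n \<Longrightarrow> A * M = M * A \<Longrightarrow> M *\<^sub>v v = 0\<^sub>v n \<Longrightarrow> M = 0\<^sub>m n n"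
  shows "E * ((- s) \<cdot>\<^sub>m L) = 1\<^sub>m n"
proof -
  have EL: "E * L \<in> carrier_mat n n" using E L by (simp add: square_mat_simps)
  define M where "M = 1\<^sub>m n + s \<cdot>\<^sub>m (E * L)"
  have M: "M \<in> carrier_mat n n" using EL by (simp add: M_def)
  have "A * (E * L) = (A * E) * L" using A E L by (simp add: square_mat_simps)
  also have "\<dots> = E * (A * L)" unfolding AE using A E L by (simp add: square_mat_simps)
  also have "\<dots> = (E * L) * A" unfolding AL using A E L by (simp add: square_mat_simps)
  finally have "A * M = M * A"
    unfolding M_def using A EL
    by (simp add: mult_add_distrib_mat[of _ n n _ n] add_mult_distrib_mat[of _ n n _ _ n]
      mult_smult_distrib[of _ n n _ n] mult_smult_assoc_mat[of _ n n _ n] del: assoc_mult_mat)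
  moreover have "M *\<^sub>v v = 0\<^sub>v n"
    unfolding M_def using E L v ELv by (simp add: square_mat_simps)
  ultimately have "M = 0\<^sub>m n n" by (rule uniq[OF M])
  then have "M $$ (i, j) = 0" if "i < n" "j < n" for i j using that by simp
  then have "(E * ((- s) \<cdot>\<^sub>m L)) $$ (i, j) = 1\<^sub>m n $$ (i, j)" if "i < n" "j < n" for i j
    using that E L by (fastforce simp: M_def mult_smult_distrib[of _ n n _ n] add_eq_0_iff
        simp del: index_mult_mat(1) split: if_splits)
  then show ?thesis using E L by (intro eq_matI) auto
qed

end

section \<open>Invertibility through determinants, and the total inverse\<close>

lemma invertible_mat_iff_det:
  fixes X :: "'a :: field mat"
  assumes X: "X \<in> carrier_mat n n"
  shows "invertible_mat X \<longleftrightarrow> det X \<noteq> 0"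
proof
  assume "invertible_mat X"
  then obtain Y where Y: "X * Y = 1\<^sub>m (dim_row X)" "Y * X = 1\<^sub>m (dim_row Y)"
    unfolding invertible_mat_def inverts_mat_def by blast
  have "dim_row Y = n" "dim_col Y = n"
    using arg_cong[OF Y(1), of dim_col] arg_cong[OF Y(2), of dim_col] X by auto
  then have "Y \<in> carrier_mat n n" by auto
  from det_mult[OF X this] Y X show "det X \<noteq> 0" by auto
next
  assume "det X \<noteq> 0"
  then obtain Y where "Y \<in> carrier_mat n n" "X * Y = 1\<^sub>m n" "Y * X = 1\<^sub>m n"
    by (rule mat_inverse_exists[OF X])
  then show "invertible_mat X"
    using X unfolding invertible_mat_def inverts_mat_def by auto
qed

lemma minv_eqI:
  fixes X Y :: "'a :: field mat"
  assumes X: "X \<in> carrier_mat n n" and Y: "Y \<in> carrier_mat n n" and XY: "X * Y = 1\<^sub>m n"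
  shows "minv X = Y"
proof -
  have YX: "Y * X = 1\<^sub>m n" by (rule mat_mult_left_right_inverse[OF X Y XY])
  have "X \<in> Units (ring_mat TYPE('a) n ())"
    using X Y XY YX unfolding Units_def ring_mat_def by auto
  then obtain Z where Z: "mat_inverse X = Some Z"
    using mat_inverse(1)[OF X, of "()"] by auto
  then have ZX: "Z * X = 1\<^sub>m n" and Zc: "Z \<in> carrier_mat n n"
    using mat_inverse(2)[OF X] by auto
  have "Z = Z * (X * Y)" using Zc XY by simp
  also have "\<dots> = (Z * X) * Y" by (rule assoc_mult_mat[OF Zc X Y, symmetric])
  also have "\<dots> = Y" using ZX Y by simp
  finally show ?thesis using Z by (simp add: minv_def)
qed

theorem theorem2p1:
  fixes n :: nat and A B P Q R :: "real mat" and v w :: "real vec"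
  assumes A: "A \<in> carrier_mat n n"
    and v: "v \<in> carrier_vec n" and w: "w \<in> carrier_vec n"
    and B: "B = A + outer_prod v w"
    and nonres_A: "\<And>\<alpha> \<alpha>'. \<alpha> \<in> cspectrum A \<Longrightarrow> \<alpha>' \<in> cspectrum A \<Longrightarrow> \<alpha> * \<alpha>' \<noteq> 1"
    and nonres_B: "\<And>\<beta> \<beta>'. \<beta> \<in> cspectrum B \<Longrightarrow> \<beta>' \<in> cspectrum B \<Longrightarrow> \<beta> * \<beta>' \<noteq> 1"
    and nonres_AB: "\<And>\<alpha> \<beta>. \<alpha> \<in> cspectrum A \<Longrightarrow> \<beta> \<in> cspectrum B \<Longrightarrow> \<alpha> * \<beta> \<noteq> 1"
    and P: "P \<in> carrier_mat n n" "P - A * P * A\<^sup>T = outer_prod v v"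
    and Q: "Q \<in> carrier_mat n n" "Q - B\<^sup>T * Q * B = outer_prod w w"
    and R: "R \<in> carrier_mat n n" "R - A * R * B = outer_prod v w"
    and inv_P: "invertible_mat P" and inv_Q: "invertible_mat Q"
  shows "invertible_mat R \<and> invertible_mat (1\<^sub>m n + P * Q)
    \<and> cspectrum_mset (minv P * R * minv Q * R\<^sup>T) = cspectrum_mset (minv (1\<^sub>m n + P * Q))
    \<and> char_poly (minv P * R * minv Q * R\<^sup>T) = char_poly (minv (1\<^sub>m n + P * Q))
    \<and> (simple_nonzero_spectrum A \<and> simple_nonzero_spectrum B
        \<longrightarrow> similar_mat (minv P * R * minv Q * R\<^sup>T) (minv (1\<^sub>m n + P * Q)))"
proof -
  have Bc: "B \<in> carrier_mat n n" using A v w by (simp add: B)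
  have At: "A\<^sup>T \<in> carrier_mat n n" and Bt: "B\<^sup>T \<in> carrier_mat n n" using A Bc by simp_all
  have det_P: "det P \<noteq> 0" and det_Q: "det Q \<noteq> 0"
    using inv_P inv_Q invertible_mat_iff_det P(1) Q(1) by blast+
  obtain Pi where Pi: "Pi \<in> carrier_mat n n" "P * Pi = 1\<^sub>m n" "Pi * P = 1\<^sub>m n"
    by (rule mat_inverse_exists[OF P(1) det_P])
  obtain Qi where Qi: "Qi \<in> carrier_mat n n" "Q * Qi = 1\<^sub>m n" "Qi * Q = 1\<^sub>m n"
    by (rule mat_inverse_exists[OF Q(1) det_Q])
  have minv: "minv P = Pi" "minv Q = Qi"
    using minv_eqI[OF P(1) Pi(1,2)] minv_eqI[OF Q(1) Qi(1,2)] by auto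
  have nonres_At: "\<alpha> * \<gamma> \<noteq> 1" if "\<alpha> \<in> cspectrum A" "\<gamma> \<in> cspectrum (A\<^sup>T)" for \<alpha> \<gamma>
    using nonres_A that cspectrum_transpose[OF A] by simp
  have nonres_Bt: "\<alpha> * \<gamma> \<noteq> 1" if "\<alpha> \<in> cspectrum (B\<^sup>T)" "\<gamma> \<in> cspectrum B" for \<alpha> \<gamma>
    using nonres_B that cspectrum_transpose[OF Bc] by simp
  \<comment> \<open>The right-hand side \<open>outer_prod w w\<close> is symmetric, so the transpose
    of \<open>Q\<close> solves the same equation and uniqueness makes \<open>Q\<close>
    symmetric.\<close>
  have "Q\<^sup>T - B\<^sup>T * Q\<^sup>T * B = (Q - B\<^sup>T * Q * B)\<^sup>T"
    using Q(1) Bc Bt by (simp add: transpose_minus[of _ n n] transpose_mult[of _ n n _ n] assoc_mult_mat[of _ n n _ n _ n])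
  also have "\<dots> = Q - B\<^sup>T * Q * B"
    unfolding Q(2) by (rule transpose_outer_prod)
  finally have Qsym: "Q\<^sup>T = Q"
    by (rule real_stein_eqI[OF Bt Bc _ Q(1) nonres_Bt, rotated -1]) (use Q in auto)
  have "Qi\<^sup>T * Q = 1\<^sub>m n"
    using arg_cong[OF Qi(2), of transpose_mat] transpose_mult[OF Q(1) Qi(1)] Qsym by simp
  then have "Qi\<^sup>T * Q * Qi = Qi" using Qi by simp
  then have Qisym: "Qi\<^sup>T = Qi"
    using assoc_mult_mat[of "Qi\<^sup>T" n n Q n Qi n] Q Qi by simp
  have "B\<^sup>T * Q * B = Q - outer_prod w w"
    by (rule mat_diff_eqD[OF Q(1) _ Q(2)[symmetric]]) (use Q Bc in auto)
  then obtain m s d where m: "m \<in> carrier_vec n" and s: "s \<noteq> 0"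
    and BQiB: "B * Qi * B\<^sup>T = Qi - s \<cdot>\<^sub>m outer_prod m m"
    and Bg: "B *\<^sub>v (Qi *\<^sub>v w) = (- s * d) \<cdot>\<^sub>v m"
    and wg: "w \<bullet> (Qi *\<^sub>v w) = 1 - s * d * d"
    using stein_completion[OF Q(1) Qi(1) Bc w Qi(2,3) Qisym] by blast
  define g where "g = Qi *\<^sub>v w"
  have g: "g \<in> carrier_vec n" using Qi w by (simp add: g_def)
  note congr = completed_congruence[OF Qi(1) Bc _ w m _ Qisym BQiB Bg wg]
  note exists = real_commuting_exists[OF A P(1) v _ nonres_A P(2) det_P]
  note unique = real_commuting_unique[OF A P(1) _ v nonres_A P(2) det_P]

  define e where "e = A * R *\<^sub>v m + d \<cdot>\<^sub>v v"
  define f where "f = m - d \<cdot>\<^sub>v v"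
  have e: "e \<in> carrier_vec n" and f: "f \<in> carrier_vec n"
    using A R m v by (simp_all add: e_def f_def mult_carrier_mat[of _ n n _ n] mult_mat_vec_carrier[of _ n n])
  obtain F where F: "\<And>i. i < n \<Longrightarrow> F i \<in> carrier_mat n n" "\<And>i. i < n \<Longrightarrow> A * F i = F i * A"
    "\<And>i. i < n \<Longrightarrow> F i *\<^sub>v v = col R i"
  proof -
    \<comment> \<open>No bound on \<open>i\<close> is imposed: \<open>col R i\<close> has dimension
      \<open>n\<close> even for an index out of range, so a choice function exists on all
      naturals.\<close>
    have "\<exists>M. M \<in> carrier_mat n n \<and> A * M = M * A \<and> M *\<^sub>v v = col R i" for i
      using exists[of "col R i"] R by (metis col_dim carrier_matD(1))
    then show thesis by (metis that)
  qed
  \<comment> \<open>The \<open>F i\<close> are the entries of the row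
    \<open>w^T (1 - x B)^-1\<close> evaluated at \<open>x = A\<close>; contracting with
    \<open>m\<close> gives \<open>G\<close>, so that \<open>d + A G\<close> is the transfer function
    at \<open>A\<close>.\<close>
  define G where "G = mat n n (\<lambda>(r, c). \<Sum>i\<in>{0..<n}. m $ i * F i $$ (r, c))"
  have G: "G \<in> carrier_mat n n" by (simp add: G_def)
  have AG: "A * G = G * A" and Gv: "G *\<^sub>v v = R *\<^sub>v m"
    unfolding G_def by (rule commuting_linear_combination[OF A v R(1) m F]; assumption)+
  have Gm: "s \<cdot>\<^sub>v (G *\<^sub>v m) = g - R *\<^sub>v (B *\<^sub>v g)"
    unfolding G_def g_def
    by (rule intertwiner_contraction[OF A R(1) Qi(1) v w m B R(2) Qisym BQiB F]) (use unique in auto)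
  define E where "E = d \<cdot>\<^sub>m 1\<^sub>m n + A * G"
  have E: "E \<in> carrier_mat n n" using A G by (simp add: E_def)
  note op = transfer_operator[OF A R(1) G v w m g B R(2) AG Gv Gm Bg[folded g_def] wg[folded g_def],
      folded E_def e_def f_def]
  obtain L where L: "L \<in> carrier_mat n n" "A * L = L * A" "L *\<^sub>v v = f"
    by (rule exists[OF f])
  have EL: "E * ((- s) \<cdot>\<^sub>m L) = 1\<^sub>m n"
    by (rule commuting_inverse[OF A E L(1) v op(1) L(2)]) (use op(3) L(3) unique in auto)

  \<comment> \<open>The congruence with \<open>T = 1\<close> and \<open>u = - v\<close> replaces
    \<open>B\<close> by \<open>B - v w^T = A\<close>; it yields the Stein equation for
    \<open>Qi + P\<close>.\<close>
  have "1\<^sub>m n * B + outer_prod (- v) w = A"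
    using Bc by (simp add: B) (rule eq_matI, use A v w in auto)
  moreover have "1\<^sub>m n *\<^sub>v m + d \<cdot>\<^sub>v - v = f"
    by (rule eq_vecI) (use m v in \<open>auto simp: f_def\<close>)
  moreover have "outer_prod (- v) (- v) = outer_prod v v"
    by (rule eq_matI) auto
  moreover have "1\<^sub>m n * Qi * (1\<^sub>m n)\<^sup>T = Qi" using Qi(1) by simp
  ultimately have "A * Qi * A\<^sup>T = Qi + outer_prod v v - s \<cdot>\<^sub>m outer_prod f f"
    using congr[of "1\<^sub>m n" "- v"] v by simp
  then have X_stein: "(Qi + P) - A * (Qi + P) * A\<^sup>T = s \<cdot>\<^sub>m outer_prod f f"
    by (rule stein_add[OF A P(1) Qi(1) v _ P(2), rotated -1]) (use f in auto)
  have X: "Qi + P = s \<cdot>\<^sub>m (L * P * L\<^sup>T)"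
    by (rule real_stein_eqI[OF A At _ _ nonres_At])
      (use stein_commuting_smult[OF A P(1) L(1) v L(2) P(2), of s] X_stein L(1,3) P(1) Qi(1)
        in \<open>simp_all add: mult_carrier_mat[of _ n n _ n]\<close>)
  \<comment> \<open>By the Stein equation for \<open>R\<close>, the choice \<open>T = A R\<close>
    and \<open>u = v\<close> makes \<open>T B + u w^T\<close> equal to \<open>R\<close>, and the
    congruence now describes \<open>R Qi R^T\<close>.\<close>
  have "A * R * B = R - outer_prod v w"
    by (rule mat_diff_eqD[of R n n, OF _ _ R(2)[symmetric]])
      (use A R Bc in \<open>simp_all add: mult_carrier_mat[of _ n n _ n]\<close>)
  then have "A * R * B + outer_prod v w = R"
    using R(1) v w by (simp del: assoc_mult_mat) (rule eq_matI, auto)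
  moreover have "A * R * Qi * (A * R)\<^sup>T = A * (R * Qi * R\<^sup>T) * A\<^sup>T"
    using A R(1) Qi(1) by (simp add: transpose_mult[of _ n n _ n] assoc_mult_mat[of _ n n _ n _ n]
        mult_carrier_mat[of _ n n _ n])
  ultimately have "R * Qi * R\<^sup>T = A * (R * Qi * R\<^sup>T) * A\<^sup>T + outer_prod v v - s \<cdot>\<^sub>m outer_prod e e"
    using congr[OF mult_carrier_mat[OF A R(1)] v] by (simp add: e_def[symmetric] del: assoc_mult_mat)
  then have Y_stein: "(P - R * Qi * R\<^sup>T) - A * (P - R * Qi * R\<^sup>T) * A\<^sup>T = s \<cdot>\<^sub>m outer_prod e e"
    by (rule stein_diff[OF A P(1) _ v _ P(2), rotated -1])
      (use e R Qi in \<open>simp_all add: mult_carrier_mat[of _ n n _ n]\<close>)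
  have Y: "P - R * Qi * R\<^sup>T = s \<cdot>\<^sub>m (E * P * E\<^sup>T)"
    by (rule real_stein_eqI[OF A At _ _ nonres_At])
      (use stein_commuting_smult[OF A P(1) E v op(1) P(2), of s] Y_stein op(2) E P(1) R(1) Qi(1)
        in \<open>simp_all add: mult_carrier_mat[of _ n n _ n]\<close>)
  obtain S where S: "S \<in> carrier_mat n n" "(1\<^sub>m n + P * Q) * S = 1\<^sub>m n"
    "similar_mat (Pi * R * Qi * R\<^sup>T) S"
    by (rule similar_of_factorizations[OF P(1) Pi(1-3) Q(1) Qi(1-3) R(1) E L(1) s X Y EL])
  have PQ: "1\<^sub>m n + P * Q \<in> carrier_mat n n" using P Q by simp
  have "det (1\<^sub>m n + P * Q) * det S = 1" using det_mult[OF PQ S(1)] S(2) by simp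
  then have det_PQ: "det (1\<^sub>m n + P * Q) \<noteq> 0" and det_S: "det S \<noteq> 0" by auto
  define W where "W = Pi * R * Qi * R\<^sup>T"
  have W: "W \<in> carrier_mat n n"
    unfolding W_def by (intro mult_carrier_mat[of _ n n _ n]) (use Pi R Qi in auto)
  have char: "char_poly W = char_poly S"
    using char_poly_similar[OF S(3)] by (simp add: W_def)
  \<comment> \<open>\<open>R\<close> is a factor of \<open>W\<close>, and \<open>W\<close> is
    similar to the invertible matrix \<open>S\<close>.\<close>
  have "det R \<noteq> 0"
  proof
    assume "det R = 0"
    then have "det W = 0"
      unfolding W_def using Pi Qi R
      by (simp add: det_mult[of _ n] mult_carrier_mat[of _ n n _ n])
    moreover have "det W = det S"
      using det_similar[OF S(3)] by (simp add: W_def)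
    ultimately show False using det_S by simp
  qed
  moreover have "cspectrum_mset W = cspectrum_mset S"
    unfolding cspectrum_mset_def of_real_hom.char_poly_hom[OF W] of_real_hom.char_poly_hom[OF S(1)] char ..
  moreover have "minv (1\<^sub>m n + P * Q) = S"
    by (rule minv_eqI[OF PQ S(1,2)])
  ultimately show ?thesis
    using det_PQ char S(3) PQ R(1) unfolding minv W_def by (simp add: invertible_mat_iff_det[of _ n])
qed

end
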